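(* Let $\pi$ be a factor code from an irreducible shift of finite type $X$ onto a sofic shift $Y$, and let $d=d_\pi$. Then $\pi$ is constant-class-to-one, i.e. $d_\pi^r(y)=d$ for all $y\in Y$, if and only if it is constant-left-class-to-one, i.e. $d_\pi^l(y)=d$ for all $y\in Y$.
   Context: Shift spaces are closed shift-invariant subsets of $\mathcal{A}^{\mathbb{Z}}$ for a finite alphabet $\mathcal{A}$; $\mathcal{B}(X)$ is the set of words occurring in points of $X$; $X$ is irreducible if for all $u,v\in\mathcal{B}(X)$ there is $w$ with $uwv\in\mathcal{B}(X)$. $X$ is a shift of finite type if for some $k\ge 0$ every $w\in\mathcal{B}(X)$ of length $k$ satisfies: $uw,wv\in\mathcal{B}(X)$ implies $uwv\in\mathcal{B}(X)$. A factor code is a continuous shift-commuting surjection; a sofic shift is a factor of a shift of finite type. Let $x,x'\in X$ with $\pi(x)=\pi(x')$ and $m\in\mathbb{Z}$. A right $m$-bridge from $x$ to $x'$ is a point $z\in X$ with $\pi(z)=\pi(x)$ such that for some $n>m$, $z|_{(-\infty,m]}=x|_{(-\infty,m]}$ and $z|_{[n,\infty)}=x'|_{[n,\infty)}$. A left $m$-bridge from $x$ to $x'$ is a point $z\in X$ with $\pi(z)=\pi(x)$ such that for some $n<m$, $z|_{(-\infty,n]}=x'|_{(-\infty,n]}$ and $z|_{[m,\infty)}=x|_{[m,\infty)}$. Write $x\to^r x'$ (resp. $x\to^l x'$) if for every $m\in\mathbb{Z}$ there is a right (resp. left) $m$-bridge from $x$ to $x'$. Points $x,x'$ in the same fibre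 are right equivalent if $x\to^r x'$ and $x'\to^r x$, and left equivalent if $x\to^l x'$ and $x'\to^l x$. For $y\in Y$, $d_\pi^r(y)$ and $d_\pi^l(y)$ are the numbers of right, respectively left, equivalence classes in $\pi^{-1}(y)$ (always finite). The class degree of $\pi$ is $d_\pi=\min_{y\in Y}d_\pi^r(y)$, and it is known that also $d_\pi=\min_{y\in Y}d_\pi^l(y)$. *)

theory Defs
  imports "HOL-Analysis.Analysis"
begin

(* Points are functions int => 'a; an alphabet is a finite set A :: 'a set, and
   topspace (full_shift_topology A) is the set of points with all entries in A. *)
definition full_shift_topology :: "'a set \<Rightarrow> (int \<Rightarrow> 'a) topology" where
  "full_shift_topology A = product_topology (\<lambda>_. discrete_topology A) UNIV"

definition shift_map :: "(int \<Rightarrow> 'a) \<Rightarrow> (int \<Rightarrow> 'a)" where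
  "shift_map x = (\<lambda>i. x (i + 1))"

definition shift_space :: "'a set \<Rightarrow> (int \<Rightarrow> 'a) set \<Rightarrow> bool" where
  "shift_space A X \<longleftrightarrow>
     finite A \<and> closedin (full_shift_topology A) X \<and> shift_map ` X = X"

(* The empty word is included, since [i..j] = [] for j < i. *)
definition language :: "(int \<Rightarrow> 'a) set \<Rightarrow> 'a list set" where
  "language X = {map x [i..j] | x i j. x \<in> X}"

definition irreducible_shift :: "(int \<Rightarrow> 'a) set \<Rightarrow> bool" where
  "irreducible_shift X \<longleftrightarrow>
     (\<forall>u\<in>language X. \<forall>v\<in>language X. \<exists>w. u @ w @ v \<in> language X)"

definition shift_of_finite_type :: "'a set \<Rightarrow> (int \<Rightarrow> 'a) set \<Rightarrow> bool" where
  "shift_of_finite_type A X \<longleftrightarrow>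
     shift_space A X \<and>
     (\<exists>k. \<forall>w\<in>language X. length w = k \<longrightarrow>
        (\<forall>u v. u @ w \<in> language X \<and> w @ v \<in> language X \<longrightarrow> u @ w @ v \<in> language X))"

definition factor_code ::
  "'a set \<Rightarrow> (int \<Rightarrow> 'a) set \<Rightarrow> 'b set \<Rightarrow> (int \<Rightarrow> 'b) set \<Rightarrow>
   ((int \<Rightarrow> 'a) \<Rightarrow> (int \<Rightarrow> 'b)) \<Rightarrow> bool" where
  "factor_code A X B Y \<pi> \<longleftrightarrow>
     shift_space A X \<and> shift_space B Y \<and>
     continuous_map (subtopology (full_shift_topology A) X)
                    (subtopology (full_shift_topology B) Y) \<pi> \<and>
     (\<forall>x\<in>X. \<pi> (shift_map x) = shift_map (\<pi> x)) \<and>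
     \<pi> ` X = Y"

(* The alphabet of the covering shift of finite type is taken inside nat. This
   loses no generality, as every finite alphabet can be renamed by naturals. *)
definition sofic_shift :: "'b set \<Rightarrow> (int \<Rightarrow> 'b) set \<Rightarrow> bool" where
  "sofic_shift B Y \<longleftrightarrow>
     (\<exists>(C :: nat set) Z \<phi>. shift_of_finite_type C Z \<and> factor_code C Z B Y \<phi>)"

definition fibre ::
  "(int \<Rightarrow> 'a) set \<Rightarrow> ((int \<Rightarrow> 'a) \<Rightarrow> (int \<Rightarrow> 'b)) \<Rightarrow> (int \<Rightarrow> 'b) \<Rightarrow> (int \<Rightarrow> 'a) set" where
  "fibre X \<pi> y = {x \<in> X. \<pi> x = y}"

definition right_bridge ::
  "(int \<Rightarrow> 'a) set \<Rightarrow> ((int \<Rightarrow> 'a) \<Rightarrow> (int \<Rightarrow> 'b)) \<Rightarrow> int \<Rightarrow>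
   (int \<Rightarrow> 'a) \<Rightarrow> (int \<Rightarrow> 'a) \<Rightarrow> (int \<Rightarrow> 'a) \<Rightarrow> bool" where
  "right_bridge X \<pi> m x x' z \<longleftrightarrow>
     z \<in> X \<and> \<pi> z = \<pi> x \<and>
     (\<exists>n>m. (\<forall>i\<le>m. z i = x i) \<and> (\<forall>i\<ge>n. z i = x' i))"

(* A left bridge from x to x' carries x on the right and x' on the left. *)
definition left_bridge ::
  "(int \<Rightarrow> 'a) set \<Rightarrow> ((int \<Rightarrow> 'a) \<Rightarrow> (int \<Rightarrow> 'b)) \<Rightarrow> int \<Rightarrow>
   (int \<Rightarrow> 'a) \<Rightarrow> (int \<Rightarrow> 'a) \<Rightarrow> (int \<Rightarrow> 'a) \<Rightarrow> bool" where
  "left_bridge X \<pi> m x x' z \<longleftrightarrow>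
     z \<in> X \<and> \<pi> z = \<pi> x \<and>
     (\<exists>n<m. (\<forall>i\<le>n. z i = x' i) \<and> (\<forall>i\<ge>m. z i = x i))"

definition right_leads ::
  "(int \<Rightarrow> 'a) set \<Rightarrow> ((int \<Rightarrow> 'a) \<Rightarrow> (int \<Rightarrow> 'b)) \<Rightarrow> (int \<Rightarrow> 'a) \<Rightarrow> (int \<Rightarrow> 'a) \<Rightarrow> bool" where
  "right_leads X \<pi> x x' \<longleftrightarrow> (\<forall>m. \<exists>z. right_bridge X \<pi> m x x' z)"

definition left_leads ::
  "(int \<Rightarrow> 'a) set \<Rightarrow> ((int \<Rightarrow> 'a) \<Rightarrow> (int \<Rightarrow> 'b)) \<Rightarrow> (int \<Rightarrow> 'a) \<Rightarrow> (int \<Rightarrow> 'a) \<Rightarrow> bool" where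
  "left_leads X \<pi> x x' \<longleftrightarrow> (\<forall>m. \<exists>z. left_bridge X \<pi> m x x' z)"

definition right_equivalence ::
  "(int \<Rightarrow> 'a) set \<Rightarrow> ((int \<Rightarrow> 'a) \<Rightarrow> (int \<Rightarrow> 'b)) \<Rightarrow> (int \<Rightarrow> 'b) \<Rightarrow>
   ((int \<Rightarrow> 'a) \<times> (int \<Rightarrow> 'a)) set" where
  "right_equivalence X \<pi> y =
     {(x, x') \<in> fibre X \<pi> y \<times> fibre X \<pi> y. right_leads X \<pi> x x' \<and> right_leads X \<pi> x' x}"

definition left_equivalence ::
  "(int \<Rightarrow> 'a) set \<Rightarrow> ((int \<Rightarrow> 'a) \<Rightarrow> (int \<Rightarrow> 'b)) \<Rightarrow> (int \<Rightarrow> 'b) \<Rightarrow>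
   ((int \<Rightarrow> 'a) \<times> (int \<Rightarrow> 'a)) set" where
  "left_equivalence X \<pi> y =
     {(x, x') \<in> fibre X \<pi> y \<times> fibre X \<pi> y. left_leads X \<pi> x x' \<and> left_leads X \<pi> x' x}"

(* For factor codes on shifts of finite type the set of classes is finite, so
   the convention that card is 0 on infinite sets does not come into play. *)
definition right_class_number ::
  "(int \<Rightarrow> 'a) set \<Rightarrow> ((int \<Rightarrow> 'a) \<Rightarrow> (int \<Rightarrow> 'b)) \<Rightarrow> (int \<Rightarrow> 'b) \<Rightarrow> nat" where
  "right_class_number X \<pi> y = card (fibre X \<pi> y // right_equivalence X \<pi> y)"

definition left_class_number ::
  "(int \<Rightarrow> 'a) set \<Rightarrow> ((int \<Rightarrow> 'a) \<Rightarrow> (int \<Rightarrow> 'b)) \<Rightarrow> (int \<Rightarrow> 'b) \<Rightarrow> nat" where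
  "left_class_number X \<pi> y = card (fibre X \<pi> y // left_equivalence X \<pi> y)"

(* An infimum of naturals over a nonempty index set is attained, so this is a
   minimum whenever Y is nonempty. *)
definition class_degree ::
  "(int \<Rightarrow> 'a) set \<Rightarrow> (int \<Rightarrow> 'b) set \<Rightarrow> ((int \<Rightarrow> 'a) \<Rightarrow> (int \<Rightarrow> 'b)) \<Rightarrow> nat" where
  "class_degree X Y \<pi> = (INF y\<in>Y. right_class_number X \<pi> y)"

definition constant_class_to_one ::
  "(int \<Rightarrow> 'a) set \<Rightarrow> (int \<Rightarrow> 'b) set \<Rightarrow> ((int \<Rightarrow> 'a) \<Rightarrow> (int \<Rightarrow> 'b)) \<Rightarrow> bool" where
  "constant_class_to_one X Y \<pi> \<longleftrightarrow>
     (\<forall>y\<in>Y. right_class_number X \<pi> y = class_degree X Y \<pi>)"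

(* class_degree is the minimum of the right class numbers here as well. *)
definition constant_left_class_to_one ::
  "(int \<Rightarrow> 'a) set \<Rightarrow> (int \<Rightarrow> 'b) set \<Rightarrow> ((int \<Rightarrow> 'a) \<Rightarrow> (int \<Rightarrow> 'b)) \<Rightarrow> bool" where
  "constant_left_class_to_one X Y \<pi> \<longleftrightarrow>
     (\<forall>y\<in>Y. left_class_number X \<pi> y = class_degree X Y \<pi>)"

end

theory Submission
  imports Defs
begin

text \<open>
  The right and the left class numbers are both governed by one quantity that does not
  distinguish the two directions of time. Call a window \<open>[a, b]\<close> of a point \<open>y\<close> of \<open>Y\<close>
  \<open>d\<close>-routed if there are a position \<open>c\<close> in it and at most \<open>d\<close> local patterns such that
  every point whose image agrees with \<open>y\<close> on \<open>[a, b]\<close> can be changed strictly inside the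
  window, without changing its image, so that it shows one of these patterns around \<open>c\<close>.
  This is the transition block of depth at most \<open>d\<close> from the theory of class degree.

  If \<open>y\<close> has \<open>d\<close>-routed windows arbitrarily far to the right, then among any \<open>d + 1\<close> points
  of its fibre two are sent through the same pattern in infinitely many of these windows;
  crossing over at that pattern gives bridges both ways, so the two points are right
  equivalent and there are at most \<open>d\<close> right classes (\<open>right_class_number_le\<close>). Windows far
  to the left bound the number of left classes (\<open>left_class_number_le\<close>). Conversely, if \<open>y\<close>
  has at most \<open>d\<close> right classes, then the pieces of one representative per class serve as
  patterns, and compactness turns the bridges to and from the representatives into one
  finite \<open>d\<close>-routed window (\<open>routed_if_right_class_number_le\<close>).

  Two consequences finish the proof. If every \<open>y\<close> has at most \<open>d\<close> right classes, then by
  compactness one window length works for all points, so routed windows occur everywhere and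
  every \<open>y\<close> has at most \<open>d\<close> left classes (\<open>left_class_number_le_if_right\<close>). And if a single
  \<open>y\<close> has at most \<open>d\<close> right classes, irreducibility provides a point in which its routed
  window recurs infinitely often to the left, hence a point with at most \<open>d\<close> left classes
  (\<open>left_class_number_le_right\<close>). Reversing time gives both facts with left and right
  exchanged. So the class degree is a lower bound for the numbers of both kinds, and it is
  an upper bound for all numbers of one kind iff it is one for all numbers of the other kind.
\<close>

section \<open>Windows, translation, splicing and reflection\<close>

definition agree :: "int \<Rightarrow> int \<Rightarrow> (int \<Rightarrow> 'a) \<Rightarrow> (int \<Rightarrow> 'a) \<Rightarrow> bool" where
  "agree a b x z \<longleftrightarrow> (\<forall>i. a \<le> i \<longrightarrow> i \<le> b \<longrightarrow> x i = z i)"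

definition translate :: "int \<Rightarrow> (int \<Rightarrow> 'a) \<Rightarrow> (int \<Rightarrow> 'a)" where
  "translate t x = (\<lambda>i. x (i + t))"

definition splice_at :: "int \<Rightarrow> (int \<Rightarrow> 'a) \<Rightarrow> (int \<Rightarrow> 'a) \<Rightarrow> (int \<Rightarrow> 'a)" where
  "splice_at i x z = (\<lambda>j. if j \<le> i then x j else z j)"

definition reflect :: "(int \<Rightarrow> 'a) \<Rightarrow> (int \<Rightarrow> 'a)" where
  "reflect x = (\<lambda>i. x (- i))"

lemma agreeD: "agree a b x z \<Longrightarrow> a \<le> i \<Longrightarrow> i \<le> b \<Longrightarrow> x i = z i"
  by (simp add: agree_def)

lemma agree_sym: "agree a b x z \<Longrightarrow> agree a b z x"
  by (simp add: agree_def)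

lemma agree_trans: "agree a b x z \<Longrightarrow> agree a b z w \<Longrightarrow> agree a b x w"
  by (simp add: agree_def)

lemma agree_mono: "agree a b x z \<Longrightarrow> a \<le> a' \<Longrightarrow> b' \<le> b \<Longrightarrow> agree a' b' x z"
  by (simp add: agree_def)

lemma agree_translate: "agree a b (translate t x) (translate t z) \<longleftrightarrow> agree (a + t) (b + t) x z"
proof
  assume *: "agree a b (translate t x) (translate t z)"
  show "agree (a + t) (b + t) x z"
    unfolding agree_def
  proof (intro allI impI)
    fix i assume "a + t \<le> i" "i \<le> b + t"
    then show "x i = z i" using agreeD [OF *, of "i - t"] by (simp add: translate_def)
  qed
qed (simp add: agree_def translate_def)

lemma translate_translate [simp]: "translate s (translate t x) = translate (s + t) x"
  by (simp add: translate_def add.assoc)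

lemma translate_0 [simp]: "translate 0 x = x"
  by (simp add: translate_def)

lemma reflect_reflect [simp]: "reflect (reflect x) = x"
  by (simp add: reflect_def)

lemma reflect_eq_iff [simp]: "reflect x = reflect z \<longleftrightarrow> x = z"
  by (metis reflect_reflect)

lemma agree_reflect: "agree a b (reflect x) (reflect z) \<longleftrightarrow> agree (- b) (- a) x z"
proof
  assume *: "agree a b (reflect x) (reflect z)"
  show "agree (- b) (- a) x z"
    unfolding agree_def
  proof (intro allI impI)
    fix i assume "- b \<le> i" "i \<le> - a"
    then show "x i = z i" using agreeD [OF *, of "- i"] by (simp add: reflect_def)
  qed
qed (simp add: agree_def reflect_def)

lemma reflect_translate: "reflect (translate t x) = translate (- t) (reflect x)"
  by (simp add: reflect_def translate_def)

section \<open>Counting classes by collisions\<close>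

text \<open>
  Choosing one representative per class, more than \<open>d\<close> classes would give \<open>d + 1\<close> pairwise
  inequivalent points. Finiteness belongs to the conclusion because \<open>card\<close> is 0 on infinite
  sets.
\<close>

lemma card_quotient_le_if_collisions:
  assumes E: "equiv F E"
    and coll: "\<And>T. T \<subseteq> F \<Longrightarrow> finite T \<Longrightarrow> card T = Suc d \<Longrightarrow> \<exists>s\<in>T. \<exists>t\<in>T. s \<noteq> t \<and> (s, t) \<in> E"
  shows "finite (F // E) \<and> card (F // E) \<le> d"
proof (rule ccontr)
  assume neg: "\<not> (finite (F // E) \<and> card (F // E) \<le> d)"
  obtain Q where Q: "Q \<subseteq> F // E" "finite Q" "card Q = Suc d"
  proof (cases "finite (F // E)")
    case True
    then have "Suc d \<le> card (F // E)" using neg by simp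
    then show ?thesis using obtain_subset_with_card_n that by (metis)
  next
    case False
    then show ?thesis using infinite_arbitrarily_large that by blast
  qed
  define r where "r q = (SOME s. s \<in> q)" for q :: "'a set"
  have r: "r q \<in> q" if "q \<in> Q" for q
    using that Q(1) in_quotient_imp_non_empty [OF E] some_in_eq unfolding r_def by blast
  have same: "p = q" if "p \<in> Q" "q \<in> Q" "(r p, r q) \<in> E" for p q
    using quotient_eqI [OF E, of p q "r p" "r q"] that r Q(1) by blast
  have refl: "(s, s) \<in> E" if "s \<in> F" for s
    using E that by (meson equiv_class_self equiv_def refl_onD)
  have rF: "r q \<in> F" if "q \<in> Q" for q
    using r [OF that] that Q(1) in_quotient_imp_subset [OF E] by blast
  have "inj_on r Q"
    by (rule inj_onI) (metis same refl rF)
  then have "card (r ` Q) = Suc d" using Q card_image by metis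
  then obtain s t where "s \<in> r ` Q" "t \<in> r ` Q" "s \<noteq> t" "(s, t) \<in> E"
    using coll [of "r ` Q"] rF Q(2) by blast
  then show False using same by blast
qed

text \<open>
  The infinite pigeonhole step: a collision at every distance, with finitely many possible
  pairs, can be attributed to a single pair. Antitonicity replaces \<open>infinitely often\<close>
  by \<open>always\<close>.
\<close>

lemma persistent_pair:
  assumes "finite T"
    and ex: "\<And>m::nat. \<exists>s\<in>T. \<exists>t\<in>T. s \<noteq> t \<and> P m s t"
    and anti: "\<And>m n s t. P n s t \<Longrightarrow> m \<le> n \<Longrightarrow> P m s t"
  shows "\<exists>s\<in>T. \<exists>t\<in>T. s \<noteq> t \<and> (\<forall>m. P m s t)"
proof (rule ccontr)
  assume "\<not> ?thesis"
  then have "\<forall>s\<in>T. \<forall>t\<in>T. \<exists>m. s \<noteq> t \<longrightarrow> \<not> P m s t" by blast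
  then obtain g where g: "\<And>s t. s \<in> T \<Longrightarrow> t \<in> T \<Longrightarrow> s \<noteq> t \<Longrightarrow> \<not> P (g s t) s t"
    by metis
  define N where "N = Max ((\<lambda>(s, t). g s t) ` (T \<times> T))"
  have N: "g s t \<le> N" if "s \<in> T" "t \<in> T" for s t
    unfolding N_def using that \<open>finite T\<close> by (intro Max_ge) auto
  obtain s t where "s \<in> T" "t \<in> T" "s \<noteq> t" "P N s t" using ex by blast
  then show False using g anti N by blast
qed

section \<open>The axioms of a factor code that are symmetric in time\<close>

text \<open>
  The facts about a factor code on an irreducible shift of finite type that the argument
  uses. Each is invariant under reversing time, so that every result about right classes has
  a mirror image. One constant \<open>L\<close> serves both as the radius of the block map that defines
  \<open>\<pi>\<close> and as the memory of the shift of finite type. Compactness appears as the existence of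
  cluster points, and irreducibility as the existence of a point that follows \<open>x\<close> on a window
  and \<open>z\<close> on a later one.
\<close>

locale fibre_system =
  fixes A :: "'a set" and X :: "(int \<Rightarrow> 'a) set"
    and \<pi> :: "(int \<Rightarrow> 'a) \<Rightarrow> (int \<Rightarrow> 'b)" and L :: int
  assumes finite_alphabet: "finite A"
    and in_alphabet: "x \<in> X \<Longrightarrow> x i \<in> A"
    and L_nonneg: "0 \<le> L"
    and cluster: "(\<And>k::nat. f k \<in> X) \<Longrightarrow> \<exists>x\<in>X. \<forall>n. \<exists>\<^sub>\<infinity>k. agree (- n) n (f k) x"
    and translate_in: "x \<in> X \<Longrightarrow> translate t x \<in> X"
    and \<pi>_translate: "x \<in> X \<Longrightarrow> \<pi> (translate t x) = translate t (\<pi> x)"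
    and \<pi>_local: "x \<in> X \<Longrightarrow> z \<in> X \<Longrightarrow> agree (i - L) (i + L) x z \<Longrightarrow> \<pi> x i = \<pi> z i"
    and splice_in: "x \<in> X \<Longrightarrow> z \<in> X \<Longrightarrow> agree (i - L) (i + L) x z \<Longrightarrow> splice_at i x z \<in> X"
    and connect: "x \<in> X \<Longrightarrow> z \<in> X \<Longrightarrow> 0 \<le> n \<Longrightarrow>
       \<exists>t>n. \<exists>s\<in>X. agree (- n) n s x \<and> agree (- n) n (translate t s) z"
begin

text \<open>
  Around each position the splice looks like one of its two parts, up to the radius of \<open>\<pi>\<close>,
  because the parts agree near the seam.
\<close>

lemma \<pi>_splice:
  assumes "x \<in> X" "z \<in> X" "agree (i - L) (i + L) x z"
  shows "\<pi> (splice_at i x z) = splice_at i (\<pi> x) (\<pi> z)"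
proof
  fix j
  have s: "splice_at i x z \<in> X" by (rule splice_in [OF assms])
  show "\<pi> (splice_at i x z) j = splice_at i (\<pi> x) (\<pi> z) j"
  proof (cases "j \<le> i")
    case True
    then have "agree (j - L) (j + L) (splice_at i x z) x"
      using assms(3) by (auto simp: agree_def splice_at_def)
    then show ?thesis using \<pi>_local [OF s assms(1)] True by (simp add: splice_at_def)
  next
    case False
    then have "agree (j - L) (j + L) (splice_at i x z) z"
      using assms(3) by (auto simp: agree_def splice_at_def)
    then show ?thesis using \<pi>_local [OF s assms(2)] False by (simp add: splice_at_def)
  qed
qed

lemma splice_fibre:
  assumes "x \<in> X" "z \<in> X" "agree (i - L) (i + L) x z" "\<pi> x = \<pi> z"
  shows "splice_at i x z \<in> X" "\<pi> (splice_at i x z) = \<pi> x"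
  using splice_in [OF assms(1-3)] \<pi>_splice [OF assms(1-3)] assms(4)
  by (auto simp: splice_at_def)

lemma cluster_at:
  assumes "\<And>k::nat. f k \<in> X"
  obtains x where "x \<in> X" "\<And>n N. \<exists>k\<ge>N. agree (- n) n (f k) x"
proof -
  obtain x where "x \<in> X" "\<forall>n. \<exists>\<^sub>\<infinity>k. agree (- n) n (f k) x"
    using cluster assms by blast
  then show ?thesis using that unfolding INFM_nat_le by blast
qed

lemma agree_\<pi>:
  assumes "x \<in> X" "z \<in> X" "agree (a - L) (b + L) x z"
  shows "agree a b (\<pi> x) (\<pi> z)"
  unfolding agree_def
proof (intro allI impI)
  fix i assume "a \<le> i" "i \<le> b"
  then show "\<pi> x i = \<pi> z i"
    by (intro \<pi>_local assms agree_mono [OF assms(3)]) auto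
qed

section \<open>Bridges and the two equivalence relations\<close>

text \<open>
  With the start and the end of the transition as explicit parameters, one notion covers
  bridges in both directions: a left bridge from \<open>x\<close> to \<open>x'\<close> is a transition from \<open>x'\<close> to \<open>x\<close>.
\<close>

definition bridged :: "int \<Rightarrow> int \<Rightarrow> (int \<Rightarrow> 'a) \<Rightarrow> (int \<Rightarrow> 'a) \<Rightarrow> bool" where
  "bridged a b x x' \<longleftrightarrow>
     (\<exists>z\<in>X. \<pi> z = \<pi> x \<and> (\<forall>i\<le>a. z i = x i) \<and> (\<forall>i\<ge>b. z i = x' i))"

lemma bridged_mono: "bridged a b x x' \<Longrightarrow> a' \<le> a \<Longrightarrow> b \<le> b' \<Longrightarrow> bridged a' b' x x'"
  unfolding bridged_def by (meson order_trans)

lemma bridged_refl: "x \<in> X \<Longrightarrow> bridged a b x x"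
  unfolding bridged_def by blast

text \<open>
  The two bridges both follow \<open>x'\<close> on a window of length \<open>2 * L\<close>, so they can be spliced
  at its centre.
\<close>

lemma bridged_trans:
  assumes "bridged a b x x'" "bridged a' b' x' x''" "\<pi> x = \<pi> x'"
    and "a \<le> b" "b + 2 * L \<le> a'" "a' < b'"
  shows "bridged a b' x x''"
proof -
  obtain z1 where z1: "z1 \<in> X" "\<pi> z1 = \<pi> x" "\<And>i. i \<le> a \<Longrightarrow> z1 i = x i" "\<And>i. b \<le> i \<Longrightarrow> z1 i = x' i"
    using assms(1) unfolding bridged_def by blast
  obtain z2 where z2: "z2 \<in> X" "\<pi> z2 = \<pi> x'" "\<And>i. i \<le> a' \<Longrightarrow> z2 i = x' i" "\<And>i. b' \<le> i \<Longrightarrow> z2 i = x'' i"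
    using assms(2) unfolding bridged_def by blast
  have ag: "agree ((b + L) - L) ((b + L) + L) z1 z2"
    using z1(4) z2(3) assms(5) by (auto simp: agree_def)
  show ?thesis
    unfolding bridged_def
  proof (intro bexI conjI allI impI)
    show "splice_at (b + L) z1 z2 \<in> X" "\<pi> (splice_at (b + L) z1 z2) = \<pi> x"
      using splice_fibre [OF z1(1) z2(1) ag] z1(2) z2(2) assms(3) by auto
    show "splice_at (b + L) z1 z2 i = x i" if "i \<le> a" for i
      using that z1(3) assms(4) L_nonneg by (simp add: splice_at_def)
    show "splice_at (b + L) z1 z2 i = x'' i" if "b' \<le> i" for i
      using that z2(4) assms(5,6) L_nonneg by (simp add: splice_at_def)
  qed
qed

lemma right_leads_iff: "right_leads X \<pi> x x' \<longleftrightarrow> (\<forall>m. \<exists>n>m. bridged m n x x')"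
  unfolding right_leads_def right_bridge_def bridged_def by blast

lemma left_leads_iff:
  "\<pi> x = \<pi> x' \<Longrightarrow> left_leads X \<pi> x x' \<longleftrightarrow> (\<forall>m. \<exists>n<m. bridged n m x' x)"
  unfolding left_leads_def left_bridge_def bridged_def by (simp only:) blast

lemma right_leads_trans:
  assumes "right_leads X \<pi> x x'" "right_leads X \<pi> x' x''" "\<pi> x = \<pi> x'"
  shows "right_leads X \<pi> x x''"
  unfolding right_leads_iff
proof
  fix m
  obtain n where n: "n > m" "bridged m n x x'"
    using assms(1) unfolding right_leads_iff by blast
  obtain p where p: "p > n + 2 * L" "bridged (n + 2 * L) p x' x''"
    using assms(2) unfolding right_leads_iff by blast
  have "bridged m p x x''"
    by (rule bridged_trans [OF n(2) p(2) assms(3)]) (use n p in auto)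
  then show "\<exists>n>m. bridged m n x x''" using n p L_nonneg by (intro exI [of _ p]) auto
qed

lemma left_leads_trans:
  assumes "left_leads X \<pi> x x'" "left_leads X \<pi> x' x''" "\<pi> x = \<pi> x'" "\<pi> x' = \<pi> x''"
  shows "left_leads X \<pi> x x''"
proof -
  have "\<exists>n<m. bridged n m x'' x" for m
  proof -
    obtain n where n: "n < m" "bridged n m x' x"
      using assms(1) unfolding left_leads_iff [OF assms(3)] by blast
    obtain p where p: "p < n - 2 * L" "bridged p (n - 2 * L) x'' x'"
      using assms(2) unfolding left_leads_iff [OF assms(4)] by blast
    have "bridged p m x'' x"
      by (rule bridged_trans [OF p(2) n(2)]) (use n p assms in auto)
    then show ?thesis using n p L_nonneg by (intro exI [of _ p]) auto
  qed
  then show ?thesis using left_leads_iff assms by simp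
qed

lemma right_leads_refl: "x \<in> X \<Longrightarrow> right_leads X \<pi> x x"
  using bridged_refl gt_ex unfolding right_leads_iff by blast

lemma left_leads_refl: "x \<in> X \<Longrightarrow> left_leads X \<pi> x x"
  using bridged_refl lt_ex unfolding left_leads_iff [OF HOL.refl] by blast

lemma equiv_right: "equiv (fibre X \<pi> y) (right_equivalence X \<pi> y)"
proof (rule equivI)
  show "refl_on (fibre X \<pi> y) (right_equivalence X \<pi> y)"
    by (rule refl_onI) (auto simp: right_equivalence_def fibre_def intro: right_leads_refl)
  show "sym (right_equivalence X \<pi> y)" by (auto simp: sym_def right_equivalence_def)
  show "trans (right_equivalence X \<pi> y)"
    by (rule transI) (auto simp: right_equivalence_def fibre_def intro: right_leads_trans)
qed (auto simp: right_equivalence_def)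

lemma equiv_left: "equiv (fibre X \<pi> y) (left_equivalence X \<pi> y)"
proof (rule equivI)
  show "refl_on (fibre X \<pi> y) (left_equivalence X \<pi> y)"
    by (rule refl_onI) (auto simp: left_equivalence_def fibre_def intro: left_leads_refl)
  show "sym (left_equivalence X \<pi> y)" by (auto simp: sym_def left_equivalence_def)
  show "trans (left_equivalence X \<pi> y)"
    by (rule transI) (auto simp: left_equivalence_def fibre_def intro: left_leads_trans)
qed (auto simp: left_equivalence_def)

section \<open>Windows that route every preimage through few patterns\<close>

text \<open>
  The condition on \<open>x\<close> only involves \<open>y\<close> inside the window, so that being routed is inherited
  by every point that shows the same word. The patterns \<open>M\<close> are arbitrary functions of which
  only the entries near \<open>c\<close> matter.
\<close>

definition routed :: "nat \<Rightarrow> (int \<Rightarrow> 'b) \<Rightarrow> int \<Rightarrow> int \<Rightarrow> bool" where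
  "routed d y a b \<longleftrightarrow>
     (\<exists>c M. a \<le> c \<and> c \<le> b \<and> finite M \<and> card M \<le> d \<and>
        (\<forall>x\<in>X. agree a b (\<pi> x) y \<longrightarrow>
           (\<exists>z\<in>X. \<pi> z = \<pi> x \<and> (\<forall>i\<le>a. z i = x i) \<and> (\<forall>i\<ge>b. z i = x i) \<and>
              (\<exists>p\<in>M. agree (c - L) (c + L) z p))))"

lemma routed_mono:
  assumes "routed d y a b" "a' \<le> a" "b \<le> b'"
  shows "routed d y a' b'"
proof -
  obtain c M where cM: "a \<le> c" "c \<le> b" "finite M" "card M \<le> d"
    and M: "\<And>x. x \<in> X \<Longrightarrow> agree a b (\<pi> x) y \<Longrightarrow>
       \<exists>z\<in>X. \<pi> z = \<pi> x \<and> (\<forall>i\<le>a. z i = x i) \<and> (\<forall>i\<ge>b. z i = x i) \<and>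
          (\<exists>p\<in>M. agree (c - L) (c + L) z p)"
    using assms(1) unfolding routed_def by auto
  show ?thesis
    unfolding routed_def
  proof (intro exI [of _ c] exI [of _ M] conjI ballI impI)
    fix x assume "x \<in> X" "agree a' b' (\<pi> x) y"
    then obtain z where "z \<in> X" "\<pi> z = \<pi> x" "\<forall>i\<le>a. z i = x i" "\<forall>i\<ge>b. z i = x i"
        "\<exists>p\<in>M. agree (c - L) (c + L) z p"
      using M [of x] agree_mono assms(2,3) by blast
    then show "\<exists>z\<in>X. \<pi> z = \<pi> x \<and> (\<forall>i\<le>a'. z i = x i) \<and> (\<forall>i\<ge>b'. z i = x i) \<and>
        (\<exists>p\<in>M. agree (c - L) (c + L) z p)"
      using assms(2,3) by (intro bexI [of _ z]) auto
  qed (use cM assms in auto)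
qed

lemma routed_translate:
  assumes "routed d y a b" "agree a b (translate t y') y"
  shows "routed d y' (a + t) (b + t)"
proof -
  obtain c M where cM: "a \<le> c" "c \<le> b" "finite M" "card M \<le> d"
    and M: "\<And>x. x \<in> X \<Longrightarrow> agree a b (\<pi> x) y \<Longrightarrow>
       \<exists>z\<in>X. \<pi> z = \<pi> x \<and> (\<forall>i\<le>a. z i = x i) \<and> (\<forall>i\<ge>b. z i = x i) \<and>
          (\<exists>p\<in>M. agree (c - L) (c + L) z p)"
    using assms(1) unfolding routed_def by auto
  show ?thesis
    unfolding routed_def
  proof (intro exI [of _ "c + t"] exI [of _ "translate (- t) ` M"] conjI ballI impI)
    show "card (translate (- t) ` M) \<le> d"
      using card_image_le [OF cM(3)] cM(4) le_trans by blast
    fix x assume x: "x \<in> X" "agree (a + t) (b + t) (\<pi> x) y'"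
    have "agree a b (\<pi> (translate t x)) y"
      using x assms(2) agree_translate agree_trans by (metis \<pi>_translate)
    then obtain z p where z: "z \<in> X" "\<pi> z = \<pi> (translate t x)" "\<And>i. i \<le> a \<Longrightarrow> z i = translate t x i"
        "\<And>i. b \<le> i \<Longrightarrow> z i = translate t x i"
      and p: "p \<in> M" "agree (c - L) (c + L) z p"
      using M [of "translate t x"] translate_in x(1) by blast
    show "\<exists>z\<in>X. \<pi> z = \<pi> x \<and> (\<forall>i\<le>a + t. z i = x i) \<and> (\<forall>i\<ge>b + t. z i = x i) \<and>
        (\<exists>p\<in>translate (- t) ` M. agree (c + t - L) (c + t + L) z p)"
    proof (rule bexI [of _ "translate (- t) z"], intro conjI allI impI)
      show "\<pi> (translate (- t) z) = \<pi> x" using z x by (simp add: \<pi>_translate)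
      show "translate (- t) z i = x i" if "i \<le> a + t" for i
        using that z(3) [of "i - t"] by (simp add: translate_def)
      show "translate (- t) z i = x i" if "b + t \<le> i" for i
        using that z(4) [of "i - t"] by (simp add: translate_def)
      show "\<exists>p\<in>translate (- t) ` M. agree (c + t - L) (c + t + L) (translate (- t) z) p"
        using p by (auto simp: agree_translate algebra_simps intro!: bexI [of _ "p"])
      show "translate (- t) z \<in> X" using z(1) translate_in by blast
    qed
  qed (use cM in auto)
qed

text \<open>
  Since the alphabet is finite, all patterns of length \<open>2 * L + 1\<close> can be allowed. This yields
  the finiteness of the numbers of classes.
\<close>

lemma routed_trivial: "\<exists>D. \<forall>y a. routed D y a a"
proof (intro exI allI)
  fix y :: "int \<Rightarrow> 'b" and a :: int
  let ?M = "PiE {a - L..a + L} (\<lambda>_. A)"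
  show "routed (card A ^ nat (2 * L + 1)) y a a"
    unfolding routed_def
  proof (intro exI [of _ a] exI [of _ ?M] conjI ballI impI)
    show "finite ?M" using finite_alphabet by (simp add: finite_PiE)
    show "card ?M \<le> card A ^ nat (2 * L + 1)"
      by (simp add: card_PiE algebra_simps)
    fix x assume x: "x \<in> X"
    show "\<exists>z\<in>X. \<pi> z = \<pi> x \<and> (\<forall>i\<le>a. z i = x i) \<and> (\<forall>i\<ge>a. z i = x i) \<and>
        (\<exists>p\<in>?M. agree (a - L) (a + L) z p)"
    proof (rule bexI [of _ x], intro conjI)
      show "\<exists>p\<in>?M. agree (a - L) (a + L) x p"
        by (intro bexI [of _ "restrict x {a - L..a + L}"]) (auto simp: agree_def in_alphabet x)
    qed (use x in auto)
  qed auto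
qed

text \<open>
  More than \<open>d\<close> points cannot be routed through \<open>d\<close> patterns without two of them sharing a
  pattern. The rerouted versions of these two points then agree around \<open>c\<close>, and splicing them
  there in either order gives the two bridges.
\<close>

lemma routed_collision:
  assumes "routed d y a b" "finite T" "d < card T" "T \<subseteq> fibre X \<pi> y"
  shows "\<exists>s\<in>T. \<exists>t\<in>T. s \<noteq> t \<and> bridged a b s t \<and> bridged a b t s"
proof -
  obtain c M where cM: "a \<le> c" "c \<le> b" "finite M" "card M \<le> d"
    and M: "\<And>x. x \<in> X \<Longrightarrow> agree a b (\<pi> x) y \<Longrightarrow>
       \<exists>z\<in>X. \<pi> z = \<pi> x \<and> (\<forall>i\<le>a. z i = x i) \<and> (\<forall>i\<ge>b. z i = x i) \<and>
          (\<exists>p\<in>M. agree (c - L) (c + L) z p)"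
    using assms(1) unfolding routed_def by auto
  have T: "s \<in> X" "\<pi> s = y" if "s \<in> T" for s
    using that assms(4) by (auto simp: fibre_def)
  have "\<forall>s\<in>T. \<exists>z. z \<in> X \<and> \<pi> z = y \<and> (\<forall>i\<le>a. z i = s i) \<and> (\<forall>i\<ge>b. z i = s i) \<and>
      (\<exists>p. p \<in> M \<and> agree (c - L) (c + L) z p)"
  proof
    fix s assume s: "s \<in> T"
    have "agree a b (\<pi> s) y" using T [OF s] by (simp add: agree_def)
    then obtain z where "z \<in> X" "\<pi> z = \<pi> s" "\<forall>i\<le>a. z i = s i" "\<forall>i\<ge>b. z i = s i"
        "\<exists>p\<in>M. agree (c - L) (c + L) z p"
      using M [OF T(1) [OF s]] by blast
    then show "\<exists>z. z \<in> X \<and> \<pi> z = y \<and> (\<forall>i\<le>a. z i = s i) \<and> (\<forall>i\<ge>b. z i = s i) \<and>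
        (\<exists>p. p \<in> M \<and> agree (c - L) (c + L) z p)"
      using T(2) [OF s] by (intro exI [of _ z]) auto
  qed
  then obtain z where z': "\<forall>s\<in>T. z s \<in> X \<and> \<pi> (z s) = y \<and> (\<forall>i\<le>a. z s i = s i) \<and>
      (\<forall>i\<ge>b. z s i = s i) \<and> (\<exists>p. p \<in> M \<and> agree (c - L) (c + L) (z s) p)"
    unfolding bchoice_iff by blast
  then have z: "\<And>s. s \<in> T \<Longrightarrow> z s \<in> X" "\<And>s. s \<in> T \<Longrightarrow> \<pi> (z s) = y"
      "\<And>s i. s \<in> T \<Longrightarrow> i \<le> a \<Longrightarrow> z s i = s i" "\<And>s i. s \<in> T \<Longrightarrow> b \<le> i \<Longrightarrow> z s i = s i"
    by blast+
  obtain p where p: "\<And>s. s \<in> T \<Longrightarrow> p s \<in> M" "\<And>s. s \<in> T \<Longrightarrow> agree (c - L) (c + L) (z s) (p s)"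
    using bchoice [of T "\<lambda>s p. p \<in> M \<and> agree (c - L) (c + L) (z s) p"] z' by blast
  have "card (p ` T) \<le> card M" using p(1) cM(3) by (intro card_mono) auto
  then have "\<not> inj_on p T" using card_image [of p T] cM(4) assms(3) by linarith
  then obtain s t where st: "s \<in> T" "t \<in> T" "s \<noteq> t" "p s = p t" unfolding inj_on_def by blast
  have cross: "bridged a b s t" if "s \<in> T" "t \<in> T" "p s = p t" for s t
  proof -
    have ag: "agree (c - L) (c + L) (z s) (z t)"
      using p(2) that agree_sym agree_trans by metis
    \<comment> \<open>When \<open>b = c\<close>, position \<open>b\<close> belongs to the left part of the splice.\<close>
    have eq: "z s c = z t c" using agreeD [OF ag, of c] L_nonneg by simp
    show ?thesis
      unfolding bridged_def
    proof (intro bexI conjI allI impI)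
      show "splice_at c (z s) (z t) \<in> X" "\<pi> (splice_at c (z s) (z t)) = \<pi> s"
        using splice_fibre [OF z(1) z(1) ag] that z(2) T(2) by auto
      show "splice_at c (z s) (z t) i = s i" if "i \<le> a" for i
        using that z(3) [OF \<open>s \<in> T\<close>] cM(1) by (simp add: splice_at_def)
      show "splice_at c (z s) (z t) i = t i" if "b \<le> i" for i
        using that z(4) [OF \<open>t \<in> T\<close>, of i] cM(2) eq by (cases "i = c") (auto simp: splice_at_def)
    qed
  qed
  show ?thesis using cross [OF st(1,2,4)] cross [OF st(2,1)] st by auto
qed

lemma right_class_number_le:
  assumes "\<And>m. \<exists>a b. m \<le> a \<and> routed d y a b"
  shows "finite (fibre X \<pi> y // right_equivalence X \<pi> y) \<and> right_class_number X \<pi> y \<le> d"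
  unfolding right_class_number_def
proof (rule card_quotient_le_if_collisions [OF equiv_right])
  fix T assume T: "T \<subseteq> fibre X \<pi> y" "finite T" "card T = Suc d"
  have "\<exists>s\<in>T. \<exists>t\<in>T. s \<noteq> t \<and> (\<exists>n. bridged (int m) n s t \<and> bridged (int m) n t s)" for m
  proof -
    obtain a b where ab: "int m \<le> a" "routed d y a b" using assms by blast
    obtain s t where "s \<in> T" "t \<in> T" "s \<noteq> t" "bridged a b s t" "bridged a b t s"
      using routed_collision [OF ab(2) T(2) _ T(1)] T(3) by auto
    then show ?thesis
      using bridged_mono [OF _ ab(1) order_refl] by blast
  qed
  then have "\<exists>s\<in>T. \<exists>t\<in>T. s \<noteq> t \<and> (\<forall>m. \<exists>n. bridged (int m) n s t \<and> bridged (int m) n t s)"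
    by (rule persistent_pair [OF T(2)]) (meson bridged_mono of_nat_mono order_refl)
  then obtain s t where st: "s \<in> T" "t \<in> T" "s \<noteq> t"
    and br: "\<And>m. \<exists>n. bridged (int m) n s t \<and> bridged (int m) n t s" by blast
  have "\<exists>n>m. bridged m n s t \<and> bridged m n t s" for m
  proof -
    obtain n where "bridged (int (nat m)) n s t" "bridged (int (nat m)) n t s" using br by blast
    then have "bridged m (max n (m + 1)) s t \<and> bridged m (max n (m + 1)) t s"
      by (auto intro: bridged_mono)
    then show ?thesis by (intro exI [of _ "max n (m + 1)"]) auto
  qed
  then have "(s, t) \<in> right_equivalence X \<pi> y"
    using st T(1) unfolding right_equivalence_def right_leads_iff by blast
  then show "\<exists>s\<in>T. \<exists>t\<in>T. s \<noteq> t \<and> (s, t) \<in> right_equivalence X \<pi> y" using st by blast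
qed

lemma left_class_number_le:
  assumes "\<And>m. \<exists>a b. b \<le> m \<and> routed d y a b"
  shows "left_class_number X \<pi> y \<le> d"
proof -
  have "finite (fibre X \<pi> y // left_equivalence X \<pi> y) \<and>
      card (fibre X \<pi> y // left_equivalence X \<pi> y) \<le> d"
  proof (rule card_quotient_le_if_collisions [OF equiv_left])
    fix T assume T: "T \<subseteq> fibre X \<pi> y" "finite T" "card T = Suc d"
    have "\<exists>s\<in>T. \<exists>t\<in>T. s \<noteq> t \<and> (\<exists>n. bridged n (- int m) s t \<and> bridged n (- int m) t s)" for m
    proof -
      obtain a b where ab: "b \<le> - int m" "routed d y a b" using assms by blast
      obtain s t where "s \<in> T" "t \<in> T" "s \<noteq> t" "bridged a b s t" "bridged a b t s"
        using routed_collision [OF ab(2) T(2) _ T(1)] T(3) by auto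
      then show ?thesis
        using bridged_mono [OF _ order_refl ab(1)] by blast
    qed
    then have "\<exists>s\<in>T. \<exists>t\<in>T. s \<noteq> t \<and> (\<forall>m. \<exists>n. bridged n (- int m) s t \<and> bridged n (- int m) t s)"
      by (rule persistent_pair [OF T(2)]) (meson bridged_mono neg_le_iff_le of_nat_mono order_refl)
    then obtain s t where st: "s \<in> T" "t \<in> T" "s \<noteq> t"
      and br: "\<And>m. \<exists>n. bridged n (- int m) s t \<and> bridged n (- int m) t s" by blast
    have st\<pi>: "\<pi> s = \<pi> t" "\<pi> t = \<pi> s" using st T(1) by (auto simp: fibre_def)
    have "\<exists>n<m. bridged n m s t \<and> bridged n m t s" for m
    proof -
      obtain n where "bridged n (- int (nat (- m))) s t" "bridged n (- int (nat (- m))) t s"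
        using br by blast
      then have "bridged (min n (m - 1)) m s t \<and> bridged (min n (m - 1)) m t s"
        by (auto intro: bridged_mono)
      then show ?thesis by (intro exI [of _ "min n (m - 1)"]) auto
    qed
    then have "(s, t) \<in> left_equivalence X \<pi> y"
      using st T(1) unfolding left_equivalence_def
      by (auto simp: left_leads_iff [OF st\<pi>(1)] left_leads_iff [OF st\<pi>(2)])
    then show "\<exists>s\<in>T. \<exists>t\<in>T. s \<noteq> t \<and> (s, t) \<in> left_equivalence X \<pi> y" using st by blast
  qed
  then show ?thesis by (simp add: left_class_number_def)
qed

lemma finite_right_classes: "finite (fibre X \<pi> y // right_equivalence X \<pi> y)"
  using right_class_number_le routed_trivial by (metis order_refl)

section \<open>Few right classes produce a routed window\<close>

text \<open>
  A bridge that starts at \<open>2 * L\<close> can be used by every point of the fibre that shows the same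
  pattern on \<open>[0, 2 * L]\<close>. There are only finitely many patterns, so some length works for all
  points at once.
\<close>

lemma uniform_bridge_to:
  assumes "\<And>x. x \<in> F \<Longrightarrow> x \<in> X \<and> \<pi> x = y"
  shows "\<exists>n. \<forall>x\<in>F. right_leads X \<pi> x r \<longrightarrow> bridged L n x r"
proof (rule ccontr)
  assume "\<not> ?thesis"
  then have "\<forall>k::nat. \<exists>x. x \<in> F \<and> right_leads X \<pi> x r \<and> \<not> bridged L (int k) x r" by blast
  then obtain f where f: "\<And>k. f k \<in> F" "\<And>k. right_leads X \<pi> (f k) r"
      "\<And>k. \<not> bridged L (int k) (f k) r"
    by metis
  obtain x where x: "\<And>n N. \<exists>k\<ge>N. agree (- n) n (f k) x"
    using cluster_at [of f] f(1) assms by metis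
  obtain j where j: "agree (- (2 * L)) (2 * L) (f j) x" using x by blast
  obtain n where "bridged (2 * L) n (f j) r"
    using f(2) [of j] unfolding right_leads_iff by blast
  then obtain z where z: "z \<in> X" "\<pi> z = y" "\<And>i. i \<le> 2 * L \<Longrightarrow> z i = f j i" "\<And>i. n \<le> i \<Longrightarrow> z i = r i"
    using assms f(1) unfolding bridged_def by metis
  obtain k where k: "k \<ge> nat (max n (L + 1))" "agree (- (2 * L)) (2 * L) (f k) x" using x by blast
  have ag: "agree (L - L) (L + L) (f k) z"
    using k(2) j z(3) L_nonneg by (auto simp: agree_def)
  have "bridged L (int k) (f k) r"
    unfolding bridged_def
  proof (intro bexI conjI allI impI)
    show "splice_at L (f k) z \<in> X" "\<pi> (splice_at L (f k) z) = \<pi> (f k)"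
      using splice_fibre [OF _ z(1) ag] z(2) f(1) assms by auto
  qed (use z(4) k(1) in \<open>auto simp: splice_at_def\<close>)
  then show False using f(3) by blast
qed

lemma uniform_bridge:
  assumes "\<And>x. x \<in> F \<Longrightarrow> x \<in> X \<and> \<pi> x = y" "finite R"
  shows "\<exists>n>0. \<forall>x\<in>F. \<forall>r\<in>R. right_leads X \<pi> x r \<longrightarrow> bridged L n x r"
proof -
  obtain n where n: "\<And>r x. x \<in> F \<Longrightarrow> right_leads X \<pi> x r \<Longrightarrow> bridged L (n r) x r"
    using uniform_bridge_to [of F y] assms(1) by metis
  define N where "N = Max (insert 1 (n ` R))"
  have "N \<ge> 1" unfolding N_def using assms(2) by (intro Max_ge) auto
  moreover have "n r \<le> N" if "r \<in> R" for r
    unfolding N_def using assms(2) that by (intro Max_ge) auto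
  ultimately show ?thesis
    using n bridged_mono by (intro exI [of _ N]) (meson order_refl zero_less_one order_less_le_trans)
qed

text \<open>
  Let \<open>R\<close> contain a representative of each right class. Every point \<open>x\<close> of the fibre has a
  bridge to the representative \<open>r\<close> of its class that is complete at a time \<open>n\<close> which does not
  depend on \<open>x\<close>, and then a bridge back from \<open>r\<close> to \<open>x\<close>; between the two it shows the pattern of
  \<open>r\<close> around \<open>c = n + L\<close>. The time of return does depend on \<open>x\<close>. To make it uniform, and to
  include points whose image is \<open>y\<close> only on a finite window, suppose that every window around
  \<open>c\<close> fails to be routed through \<open>R\<close>. A cluster point \<open>x\<close> of the failing points lies in the
  fibre, and its detour through \<open>r\<close> can be copied into any failing point that is close
  enough to \<open>x\<close>.
\<close>

lemma routed_if_right_class_number_le: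
  assumes "right_class_number X \<pi> y \<le> d"
  shows "\<exists>a b. routed d y a b"
proof (rule ccontr)
  assume neg: "\<not> ?thesis"
  let ?F = "fibre X \<pi> y" and ?E = "right_equivalence X \<pi> y"
  have F: "x \<in> ?F \<longleftrightarrow> x \<in> X \<and> \<pi> x = y" for x by (auto simp: fibre_def)
  define R where "R = (\<lambda>q. SOME x. x \<in> q) ` (?F // ?E)"
  have R: "finite R" "card R \<le> d"
    using finite_right_classes assms card_image_le [OF finite_right_classes]
    unfolding R_def right_class_number_def by (auto intro: le_trans)
  have rep: "\<exists>r\<in>R. r \<in> ?F \<and> right_leads X \<pi> x r \<and> right_leads X \<pi> r x" if "x \<in> ?F" for x
  proof -
    let ?q = "?E `` {x}"
    have q: "?q \<in> ?F // ?E" using that by (rule quotientI)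
    then have "(SOME x. x \<in> ?q) \<in> ?q"
      using in_quotient_imp_non_empty [OF equiv_right] some_in_eq by blast
    then have "(x, SOME x. x \<in> ?q) \<in> ?E" by blast
    then show ?thesis using q unfolding R_def right_equivalence_def by blast
  qed
  obtain n where n: "n > 0" "\<And>x r. x \<in> ?F \<Longrightarrow> r \<in> R \<Longrightarrow> right_leads X \<pi> x r \<Longrightarrow> bridged L n x r"
    using uniform_bridge [of ?F y R] F R(1) by blast
  define c where "c = n + L"
  have "c > 0" using n L_nonneg by (simp add: c_def)
  define w where "w k = c + int k" for k :: nat
  have "\<exists>x\<in>X. agree (- w k) (w k) (\<pi> x) y \<and>
      \<not> (\<exists>z\<in>X. \<pi> z = \<pi> x \<and> (\<forall>i\<le>- w k. z i = x i) \<and> (\<forall>i\<ge>w k. z i = x i) \<and>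
           (\<exists>p\<in>R. agree (c - L) (c + L) z p))" for k
  proof -
    have "- w k \<le> c" "c \<le> w k" using \<open>c > 0\<close> by (auto simp: w_def)
    moreover have "\<not> routed d y (- w k) (w k)" using neg by blast
    ultimately show ?thesis using R unfolding routed_def by blast
  qed
  then obtain f where f: "\<And>k. f k \<in> X" "\<And>k. agree (- w k) (w k) (\<pi> (f k)) y"
    and bad: "\<And>k z. z \<in> X \<Longrightarrow> \<pi> z = \<pi> (f k) \<Longrightarrow> \<forall>i\<le>- w k. z i = f k i \<Longrightarrow> \<forall>i\<ge>w k. z i = f k i \<Longrightarrow>
           \<forall>p\<in>R. \<not> agree (c - L) (c + L) z p"
    by metis
  obtain x where x: "x \<in> X" "\<And>n N. \<exists>k\<ge>N. agree (- n) n (f k) x"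
    using cluster_at [of f] f(1) by metis
  have "\<pi> x = y"
  proof
    fix i
    obtain k where k: "k \<ge> nat \<bar>i\<bar>" "agree (- (\<bar>i\<bar> + L)) (\<bar>i\<bar> + L) (f k) x" using x(2) by blast
    have "\<pi> (f k) i = \<pi> x i"
      by (rule \<pi>_local [OF f(1) x(1)]) (rule agree_mono [OF k(2)], auto)
    moreover have "\<pi> (f k) i = y i"
      using k(1) \<open>c > 0\<close> by (intro agreeD [OF f(2)]) (auto simp: w_def)
    ultimately show "\<pi> x i = y i" by simp
  qed
  then obtain r where r: "r \<in> R" "r \<in> ?F" "right_leads X \<pi> x r" "right_leads X \<pi> r x"
    using rep F x(1) by metis
  have ry: "r \<in> X" "\<pi> r = y" using r(2) F by auto
  have "bridged L n x r" using n r x \<open>\<pi> x = y\<close> F by blast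
  then obtain z1 where z1: "z1 \<in> X" "\<pi> z1 = y" "\<And>i. i \<le> L \<Longrightarrow> z1 i = x i" "\<And>i. n \<le> i \<Longrightarrow> z1 i = r i"
    using \<open>\<pi> x = y\<close> unfolding bridged_def by metis
  obtain b where "b > c + L" "bridged (c + L) b r x"
    using r(4) unfolding right_leads_iff by blast
  then obtain z2 where b: "b > c + L" and z2: "z2 \<in> X" "\<pi> z2 = y"
      "\<And>i. i \<le> c + L \<Longrightarrow> z2 i = r i" "\<And>i. b \<le> i \<Longrightarrow> z2 i = x i"
    using ry unfolding bridged_def by metis
  \<comment> \<open>The detour of \<open>x\<close> through its representative \<open>r\<close>.\<close>
  define z where "z = splice_at c z1 z2"
  have z12: "agree (c - L) (c + L) z1 z2"
    using z1(4) z2(3) by (auto simp: agree_def c_def)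
  have zX: "z \<in> X" "\<pi> z = y"
    using splice_fibre [OF z1(1) z2(1) z12] z1(2) z2(2) by (auto simp: z_def)
  have z_left: "z i = x i" if "i \<le> L" for i
    using that z1(3) n(1) by (simp add: z_def splice_at_def c_def)
  have z_right: "z i = x i" if "b \<le> i" for i
    using that z2(4) b L_nonneg by (simp add: z_def splice_at_def)
  have z_mid: "agree (c - L) (c + L) z r"
    using z1(4) z2(3) by (auto simp: agree_def z_def splice_at_def c_def)
  obtain k where k: "k \<ge> nat (b + L + 1)" "agree (- (b + 2 * L)) (b + 2 * L) (f k) x"
    using x(2) by blast
  have wk: "w k > b + L" using k(1) \<open>c > 0\<close> by (simp add: w_def)
  have b0: "b > 0" "b > L" using b \<open>c > 0\<close> L_nonneg by auto
  \<comment> \<open>The detour is copied into \<open>f k\<close>: from \<open>f k\<close> to \<open>z\<close> at 0, and back to \<open>f k\<close> at \<open>b + L\<close>.\<close>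
  define s where "s = splice_at 0 (f k) z"
  have ag0: "agree (0 - L) (0 + L) (f k) z"
    using z_left b0 L_nonneg by (auto simp: agree_def intro!: agreeD [OF k(2)])
  have s: "s \<in> X" "\<pi> s = splice_at 0 (\<pi> (f k)) y"
    using splice_in [OF f(1) zX(1) ag0] \<pi>_splice [OF f(1) zX(1) ag0] zX(2) by (auto simp: s_def)
  have agb: "agree (b + L - L) (b + L + L) s (f k)"
    unfolding agree_def
  proof (intro allI impI)
    fix i assume i: "b + L - L \<le> i" "i \<le> b + L + L"
    then have "f k i = x i" using L_nonneg b0 by (intro agreeD [OF k(2)]) auto
    then show "s i = f k i" using i z_right b0 by (simp add: s_def splice_at_def)
  qed
  let ?s = "splice_at (b + L) s (f k)"
  have "\<forall>p\<in>R. \<not> agree (c - L) (c + L) ?s p"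
  proof (rule bad [of ?s k])
    show "?s \<in> X" by (rule splice_in [OF s(1) f(1) agb])
    show "\<pi> ?s = \<pi> (f k)"
    proof
      fix i
      have "\<pi> (f k) i = y i" if "0 < i" "i \<le> b + L"
        using that wk by (intro agreeD [OF f(2)]) auto
      then show "\<pi> ?s i = \<pi> (f k) i"
        using \<pi>_splice [OF s(1) f(1) agb] s(2) by (auto simp: splice_at_def)
    qed
    show "\<forall>i\<le>- w k. ?s i = f k i" using wk b0 L_nonneg by (auto simp: s_def splice_at_def)
    show "\<forall>i\<ge>w k. ?s i = f k i" using wk by (auto simp: splice_at_def)
  qed
  moreover have "agree (c - L) (c + L) ?s r"
    using z_mid b n(1) L_nonneg by (auto simp: agree_def s_def splice_at_def c_def)
  ultimately show False using r(1) by blast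
qed

section \<open>From right classes to left classes\<close>

text \<open>
  If no window length worked for all points, a cluster point of counterexamples for longer
  and longer windows would contain a routed window, which nearby counterexamples would share.
  By translation, windows of a common length are then routed at every position, in
  particular arbitrarily far to the left.
\<close>

lemma left_class_number_le_if_right:
  assumes "\<And>x. x \<in> X \<Longrightarrow> right_class_number X \<pi> (\<pi> x) \<le> d" "x \<in> X"
  shows "left_class_number X \<pi> (\<pi> x) \<le> d"
proof -
  have "\<exists>N. \<forall>x\<in>X. routed d (\<pi> x) (- N) N"
  proof (rule ccontr)
    assume "\<not> ?thesis"
    then have "\<forall>k::nat. \<exists>x. x \<in> X \<and> \<not> routed d (\<pi> x) (- int k) (int k)" by blast
    then obtain f where f: "\<And>k. f k \<in> X" "\<And>k. \<not> routed d (\<pi> (f k)) (- int k) (int k)" by metis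
    obtain x where x: "x \<in> X" "\<And>n N. \<exists>k\<ge>N. agree (- n) n (f k) x"
      using cluster_at [of f] f(1) by metis
    obtain a b where ab: "routed d (\<pi> x) a b"
      using routed_if_right_class_number_le assms(1) x(1) by blast
    define n where "n = max \<bar>a\<bar> \<bar>b\<bar>"
    obtain k where k: "k \<ge> nat n" "agree (- (n + L)) (n + L) (f k) x" using x(2) by blast
    have "agree a b (\<pi> (f k)) (\<pi> x)"
      by (rule agree_\<pi> [OF f(1) x(1)]) (rule agree_mono [OF k(2)], auto simp: n_def)
    then have "routed d (\<pi> (f k)) a b"
      using routed_translate [OF ab, of 0] by simp
    then have "routed d (\<pi> (f k)) (- int k) (int k)"
      by (rule routed_mono) (use k(1) in \<open>auto simp: n_def\<close>)
    then show False using f(2) by blast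
  qed
  then obtain N where N: "\<And>x. x \<in> X \<Longrightarrow> routed d (\<pi> x) (- N) N" by blast
  show ?thesis
  proof (rule left_class_number_le)
    fix m
    have "routed d (\<pi> x) (- N + (m - N)) (N + (m - N))"
      by (rule routed_translate [OF N [OF translate_in [OF assms(2), of "m - N"]]])
        (simp add: \<pi>_translate assms(2) agree_def)
    then show "\<exists>a b. b \<le> m \<and> routed d (\<pi> x) a b"
      by (intro exI conjI) (auto simp: algebra_simps)
  qed
qed

text \<open>
  A sequence of points and radii is built with each point agreeing with its predecessor on
  the window given by the predecessor's radius, while its own, larger window contains a
  further copy of the central word of \<open>x\<close> to the left. The limit contains all these copies.
\<close>

lemma left_recurrent_point:
  assumes "x \<in> X" "0 \<le> N"
  shows "\<exists>x'\<in>X. \<forall>m. \<exists>t\<le>m. agree (- N) N (translate t x') x"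
proof -
  let ?P = "\<lambda>k p. fst p \<in> X \<and> snd p \<ge> N + int k"
  let ?Q = "\<lambda>k p p'. agree (- snd p) (snd p) (fst p') (fst p) \<and> snd p \<le> snd p' \<and>
     (\<exists>t. - snd p' \<le> t - N \<and> t + N \<le> - int k \<and> agree (- N) N (translate t (fst p')) x)"
  have step: "\<exists>p'. ?P (Suc k) p' \<and> ?Q k p p'" if "?P k p" for p k
  proof -
    obtain z n where "p = (z, n)" by (cases p)
    then have p: "p = (z, n)" "z \<in> X" "n \<ge> N + int k" using that by auto
    obtain t s where t: "t > n" "s \<in> X" "agree (- n) n s x" "agree (- n) n (translate t s) z"
      using connect [OF assms(1) p(2), of n] p(3) assms(2) by auto
    \<comment> \<open>Centring \<open>s\<close> at its copy of \<open>z\<close> puts its copy of \<open>x\<close> at position \<open>- t\<close>.\<close>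
    define p' where "p' = (translate t s, t + n)"
    have "agree (- N) N (translate (- t) (fst p')) x"
      using agree_mono [OF t(3), of "- N" N] p(3) by (simp add: p'_def)
    moreover have "- snd p' \<le> - t - N" "- t + N \<le> - int k"
      using t(1) p(3) by (auto simp: p'_def)
    ultimately have "\<exists>t. - snd p' \<le> t - N \<and> t + N \<le> - int k \<and> agree (- N) N (translate t (fst p')) x"
      by blast
    moreover have "?P (Suc k) p'" "agree (- snd p) (snd p) (fst p') (fst p)" "snd p \<le> snd p'"
      using t p assms(2) by (auto simp: p'_def translate_in)
    ultimately show ?thesis by blast
  qed
  obtain g where "\<And>k. ?P k (g k) \<and> ?Q k (g k) (g (Suc k))"
  proof -
    have "\<exists>p. ?P 0 p" using assms by (intro exI [of _ "(x, N)"]) auto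
    then show ?thesis using that dependent_nat_choice [of ?P ?Q] step by blast
  qed
  then obtain z n where zn: "\<And>k. z k \<in> X" "\<And>k. n k \<ge> N + int k"
      "\<And>k. agree (- n k) (n k) (z (Suc k)) (z k)" "\<And>k. n k \<le> n (Suc k)"
    and occ: "\<And>k. \<exists>t. - n (Suc k) \<le> t - N \<and> t + N \<le> - int k \<and> agree (- N) N (translate t (z (Suc k))) x"
    using that [of "\<lambda>k. fst (g k)" "\<lambda>k. snd (g k)"] by blast
  obtain x' where x': "x' \<in> X" "\<And>n N. \<exists>k\<ge>N. agree (- n) n (z k) x'"
    using cluster_at [of z] zn(1) by metis
  have later: "agree (- n k) (n k) (z j) (z k)" if "k \<le> j" for j k
    using that
  proof (induction j rule: dec_induct)
    case base show ?case by (simp add: agree_def)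
  next
    case (step j)
    have "n k \<le> n j" using lift_Suc_mono_le [of n k j] zn(4) step by blast
    then have "agree (- n k) (n k) (z (Suc j)) (z j)" by (intro agree_mono [OF zn(3)]) auto
    then show ?case using step agree_trans by blast
  qed
  have lim: "agree (- n k) (n k) x' (z k)" for k
    using x'(2) [of k "n k"] later agree_sym agree_trans by blast
  show ?thesis
  proof (intro bexI [OF _ x'(1)] allI)
    fix m
    define k where "k = nat (- m)"
    obtain t where t: "- n (Suc k) \<le> t - N" "t + N \<le> - int k" "agree (- N) N (translate t (z (Suc k))) x"
      using occ by blast
    have "agree (- N) N (translate t x') (translate t (z (Suc k)))"
      unfolding agree_translate
      by (rule agree_mono [OF lim]) (use t zn(2) [of "Suc k"] assms(2) in auto)
    moreover have "t \<le> m" using t(2) assms(2) by (simp add: k_def split: if_splits)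
    ultimately show "\<exists>t\<le>m. agree (- N) N (translate t x') x"
      using t(3) agree_trans by blast
  qed
qed

text \<open>
  A routed window of \<open>\<pi> x\<close> is determined by a finite word of \<open>x\<close>, and it suffices that this
  word recurs to the left in some point.
\<close>

lemma left_class_number_le_right:
  assumes "x \<in> X"
  shows "\<exists>x'\<in>X. left_class_number X \<pi> (\<pi> x') \<le> right_class_number X \<pi> (\<pi> x)"
proof -
  let ?d = "right_class_number X \<pi> (\<pi> x)"
  obtain a b where ab: "routed ?d (\<pi> x) a b" using routed_if_right_class_number_le by blast
  define N where "N = max \<bar>a\<bar> \<bar>b\<bar> + L"
  have "N \<ge> 0" using L_nonneg by (simp add: N_def)
  then obtain x' where x': "x' \<in> X" "\<And>m. \<exists>t\<le>m. agree (- N) N (translate t x') x"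
    using left_recurrent_point [OF assms] by blast
  have "left_class_number X \<pi> (\<pi> x') \<le> ?d"
  proof (rule left_class_number_le)
    fix m
    obtain t where t: "t \<le> m - b" "agree (- N) N (translate t x') x" using x'(2) by blast
    have "agree a b (\<pi> (translate t x')) (\<pi> x)"
      by (rule agree_\<pi> [OF translate_in [OF x'(1)] assms], rule agree_mono [OF t(2)])
        (auto simp: N_def)
    then have "routed ?d (\<pi> x') (a + t) (b + t)"
      using routed_translate [OF ab] \<pi>_translate x'(1) by simp
    then show "\<exists>a b. b \<le> m \<and> routed ?d (\<pi> x') a b" using t(1) by (intro exI conjI) auto
  qed
  then show ?thesis using x'(1) by blast
qed

end

section \<open>Reversing time\<close>

lemma all_le_uminus: "(\<forall>i\<le>n. P (- i)) \<longleftrightarrow> (\<forall>i\<ge>- n. P i)" for n :: int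
  by (metis minus_minus neg_le_iff_le)

lemma all_ge_uminus: "(\<forall>i\<ge>n. P (- i)) \<longleftrightarrow> (\<forall>i\<le>- n. P i)" for n :: int
  by (metis minus_minus neg_le_iff_le)

lemma ex_less_uminus: "(\<exists>n<m. P (- n)) \<longleftrightarrow> (\<exists>n>- m. P n)" for m :: int
  by (metis minus_minus neg_less_iff_less)

text \<open>
  Reflecting the points and conjugating the code exchanges past and future, which makes
  every statement about right classes a statement about left ones.
\<close>

lemma left_bridge_reflect:
  "left_bridge (reflect ` X) (reflect \<circ> \<pi> \<circ> reflect) m (reflect x) (reflect x') (reflect z) \<longleftrightarrow>
   right_bridge X \<pi> (- m) x x' z"
proof -
  have "reflect z \<in> reflect ` X \<longleftrightarrow> z \<in> X" by (auto simp: image_iff)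
  moreover have "(reflect \<circ> \<pi> \<circ> reflect) (reflect z) = (reflect \<circ> \<pi> \<circ> reflect) (reflect x) \<longleftrightarrow> \<pi> z = \<pi> x"
    by simp
  moreover have "(\<forall>i\<le>n. reflect z i = reflect x' i) \<longleftrightarrow> (\<forall>i\<ge>- n. z i = x' i)" for n
    unfolding reflect_def by (rule all_le_uminus)
  moreover have "(\<forall>i\<ge>m. reflect z i = reflect x i) \<longleftrightarrow> (\<forall>i\<le>- m. z i = x i)"
    unfolding reflect_def by (rule all_ge_uminus)
  moreover have "(\<exists>n<m. (\<forall>i\<ge>- n. z i = x' i) \<and> P) \<longleftrightarrow> (\<exists>n>- m. P \<and> (\<forall>i\<ge>n. z i = x' i))" for P
    using ex_less_uminus [of m "\<lambda>n. P \<and> (\<forall>i\<ge>n. z i = x' i)"] by (simp add: conj_commute)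
  ultimately show ?thesis unfolding left_bridge_def right_bridge_def by simp
qed

lemma left_leads_reflect:
  "left_leads (reflect ` X) (reflect \<circ> \<pi> \<circ> reflect) (reflect x) (reflect x') \<longleftrightarrow>
   right_leads X \<pi> x x'"
proof -
  have "(\<exists>z. left_bridge (reflect ` X) (reflect \<circ> \<pi> \<circ> reflect) m (reflect x) (reflect x') z) \<longleftrightarrow>
      (\<exists>z. right_bridge X \<pi> (- m) x x' z)" for m
    by (metis left_bridge_reflect reflect_reflect)
  then show ?thesis unfolding left_leads_def right_leads_def by (metis minus_minus)
qed

lemma card_quotient_image:
  assumes "inj f" "E \<subseteq> F \<times> F"
  shows "card ((f ` F) // (map_prod f f ` E)) = card (F // E)"
proof -
  have cls: "(map_prod f f ` E) `` {f x} = f ` (E `` {x})" for x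
    using assms(1) by (auto simp: inj_eq image_iff)
  have "(f ` F) // (map_prod f f ` E) = (\<lambda>q. f ` q) ` (F // E)"
    unfolding quotient_def by (auto simp: cls)
  moreover have "inj_on (\<lambda>q. f ` q) (F // E)"
    using assms(1) by (auto simp: inj_on_def inj_image_eq_iff)
  ultimately show ?thesis by (simp add: card_image)
qed

lemma left_class_number_reflect:
  "left_class_number (reflect ` X) (reflect \<circ> \<pi> \<circ> reflect) (reflect y) = right_class_number X \<pi> y"
proof -
  have F: "fibre (reflect ` X) (reflect \<circ> \<pi> \<circ> reflect) (reflect y) = reflect ` fibre X \<pi> y"
    by (auto simp: fibre_def)
  have E: "left_equivalence (reflect ` X) (reflect \<circ> \<pi> \<circ> reflect) (reflect y) =
      map_prod reflect reflect ` right_equivalence X \<pi> y"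
    unfolding left_equivalence_def right_equivalence_def F
    by (auto simp: left_leads_reflect)
  have "inj reflect" by (rule injI) simp
  then show ?thesis
    unfolding left_class_number_def right_class_number_def F E
    by (rule card_quotient_image) (auto simp: right_equivalence_def)
qed

lemma right_class_number_reflect:
  "right_class_number (reflect ` X) (reflect \<circ> \<pi> \<circ> reflect) (reflect y) = left_class_number X \<pi> y"
proof -
  have "reflect ` reflect ` X = X" by (simp add: image_image)
  moreover have "reflect \<circ> (reflect \<circ> \<pi> \<circ> reflect) \<circ> reflect = \<pi>" by (simp add: fun_eq_iff)
  ultimately show ?thesis
    using left_class_number_reflect [of "reflect ` X" "reflect \<circ> \<pi> \<circ> reflect" "reflect y"] by simp
qed

lemma (in fibre_system) fibre_system_reflect:
  "fibre_system A (reflect ` X) (reflect \<circ> \<pi> \<circ> reflect) L"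
proof
  show "finite A" "0 \<le> L" by (rule finite_alphabet L_nonneg)+
  show "x i \<in> A" if "x \<in> reflect ` X" for x i
    using that in_alphabet by (auto simp: reflect_def)
  show "translate t x \<in> reflect ` X" if "x \<in> reflect ` X" for x t
    using that translate_in [of _ "- t"] by (auto simp: image_iff) (metis minus_minus reflect_translate)
  show "(reflect \<circ> \<pi> \<circ> reflect) (translate t x) = translate t ((reflect \<circ> \<pi> \<circ> reflect) x)"
    if "x \<in> reflect ` X" for x t
    using that by (auto simp: reflect_translate \<pi>_translate)
  show "(reflect \<circ> \<pi> \<circ> reflect) x i = (reflect \<circ> \<pi> \<circ> reflect) z i"
    if "x \<in> reflect ` X" "z \<in> reflect ` X" "agree (i - L) (i + L) x z" for x z i
    using that \<pi>_local [of _ _ "- i"] by (auto simp: agree_reflect reflect_def [of "\<pi> _"])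
  show "splice_at i x z \<in> reflect ` X"
    if xz: "x \<in> reflect ` X" "z \<in> reflect ` X" "agree (i - L) (i + L) x z" for x z i
  proof -
    obtain u v where uv: "x = reflect u" "u \<in> X" "z = reflect v" "v \<in> X" using xz by blast
    have ag: "agree (- i - L) (- i + L) v u"
      using xz(3) by (auto simp: uv agree_reflect intro: agree_sym)
    \<comment> \<open>After reflection the seam itself belongs to the other part, which is harmless because the parts agree there.\<close>
    have "u (- i) = v (- i)" using agreeD [OF ag, of "- i"] L_nonneg by simp
    then have "splice_at i x z = reflect (splice_at (- i) v u)"
      by (auto simp: splice_at_def reflect_def uv)
    then show ?thesis using splice_in [OF uv(4,2) ag] by blast
  qed
  show "\<exists>x\<in>reflect ` X. \<forall>n. \<exists>\<^sub>\<infinity>k. agree (- n) n (f k) x"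
    if f: "\<And>k::nat. f k \<in> reflect ` X" for f
  proof -
    have "reflect (f k) \<in> X" for k using f [of k] by auto
    then obtain x where x: "x \<in> X" "\<forall>n. \<exists>\<^sub>\<infinity>k. agree (- n) n (reflect (f k)) x"
      using cluster [of "\<lambda>k. reflect (f k)"] by blast
    have "agree (- n) n (f k) (reflect x) \<longleftrightarrow> agree (- n) n (reflect (f k)) x" for n k
      using agree_reflect [of "- n" n "reflect (f k)" x] by simp
    then show ?thesis using x by (intro bexI [of _ "reflect x"]) auto
  qed
  show "\<exists>t>n. \<exists>s\<in>reflect ` X. agree (- n) n s x \<and> agree (- n) n (translate t s) z"
    if xz: "x \<in> reflect ` X" "z \<in> reflect ` X" "0 \<le> n" for x z n
  proof -
    obtain u v where uv: "x = reflect u" "u \<in> X" "z = reflect v" "v \<in> X" using xz by blast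
    obtain t s where ts: "t > n" "s \<in> X" "agree (- n) n s v" "agree (- n) n (translate t s) u"
      using connect [OF uv(4,2) xz(3)] by blast
    have "agree (- n) n (reflect (translate t s)) x"
      using ts by (simp add: uv agree_reflect)
    moreover have "agree (- n) n (translate t (reflect (translate t s))) z"
      using ts by (simp add: uv reflect_translate) (simp add: agree_reflect)
    ultimately show ?thesis using ts translate_in by blast
  qed
qed

section \<open>Irreducible shifts of finite type satisfy the axioms\<close>

lemma shift_map_eq_translate: "shift_map = translate 1"
  by (simp add: fun_eq_iff shift_map_def translate_def)

lemma translate_in_if_shift_invariant:
  assumes "shift_map ` X = X" "x \<in> X"
  shows "translate t x \<in> X"
proof (induction t rule: int_induct [where k = 0])
  case base show ?case using assms(2) by simp
next
  case (step1 i)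
  have "translate (i + 1) x = shift_map (translate i x)"
    by (simp add: shift_map_eq_translate add.commute)
  then show ?case using step1 assms(1) by blast
next
  case (step2 i)
  then obtain z where "z \<in> X" "translate i x = shift_map z" using assms(1) by blast
  moreover have "translate (- 1) (translate i x) = translate (i - 1) x" by simp
  ultimately show ?case by (simp add: shift_map_eq_translate)
qed

lemma commutes_with_translate:
  assumes "shift_map ` X = X" "\<And>x. x \<in> X \<Longrightarrow> \<pi> (shift_map x) = shift_map (\<pi> x)" "x \<in> X"
  shows "\<pi> (translate t x) = translate t (\<pi> x)"
proof (induction t rule: int_induct [where k = 0])
  case base show ?case by simp
next
  case (step1 i)
  have "\<pi> (translate 1 (translate i x)) = translate 1 (\<pi> (translate i x))"
    using assms translate_in_if_shift_invariant unfolding shift_map_eq_translate by metis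
  then show ?case using step1 by (simp add: add.commute)
next
  case (step2 i)
  have "\<pi> (translate 1 (translate (i - 1) x)) = translate 1 (\<pi> (translate (i - 1) x))"
    using assms translate_in_if_shift_invariant unfolding shift_map_eq_translate by metis
  then have "translate (- 1) (translate i (\<pi> x)) = translate (- 1) (translate 1 (\<pi> (translate (i - 1) x)))"
    using step2 by simp
  then show ?case by simp
qed

lemma shift_space_in_alphabet: "shift_space A X \<Longrightarrow> x \<in> X \<Longrightarrow> x i \<in> A"
  using closedin_subset [of "full_shift_topology A" X]
  by (auto simp: shift_space_def full_shift_topology_def PiE_iff)

lemma openin_cylinder:
  assumes "\<And>i. x i \<in> A"
  shows "openin (full_shift_topology A) {z. (\<forall>i. z i \<in> A) \<and> agree (- n) n z x}"
proof -
  let ?U = "\<lambda>i. if - n \<le> i \<and> i \<le> n then {x i} else A"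
  have "{z. (\<forall>i. z i \<in> A) \<and> agree (- n) n z x} = PiE UNIV ?U"
    using assms by (auto simp: agree_def PiE_iff split: if_splits)
  moreover have "openin (full_shift_topology A) (PiE UNIV ?U)"
    unfolding full_shift_topology_def
    by (rule product_topology_basis)
      (use assms in \<open>auto intro: finite_subset [of _ "{- n..n}"]\<close>)
  ultimately show ?thesis by simp
qed

text \<open>
  Tychonoff: otherwise every point of \<open>X\<close> has a cylinder neighbourhood that contains only
  finitely many terms of the sequence, and finitely many such cylinders cover \<open>X\<close>.
\<close>

lemma shift_space_cluster:
  assumes X: "shift_space A X" and f: "\<And>k::nat. f k \<in> X"
  shows "\<exists>x\<in>X. \<forall>n. \<exists>\<^sub>\<infinity>k. agree (- n) n (f k) x"
proof (rule ccontr)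
  assume "\<not> ?thesis"
  then have "\<forall>x\<in>X. \<exists>n. finite {k. agree (- n) n (f k) x}"
    by (auto simp: frequently_cofinite)
  then obtain n where n: "\<And>x. x \<in> X \<Longrightarrow> finite {k. agree (- n x) (n x) (f k) x}" by metis
  let ?C = "\<lambda>x. {z. (\<forall>i. z i \<in> A) \<and> agree (- n x) (n x) z x}"
  have "compact_space (full_shift_topology A)"
    using X unfolding full_shift_topology_def shift_space_def
    by (simp add: compact_space_product_topology compact_space_discrete_topology)
  then have "compactin (full_shift_topology A) X"
    using X unfolding shift_space_def by (simp add: closedin_compact_space)
  moreover have "openin (full_shift_topology A) U" if "U \<in> ?C ` X" for U
    using that openin_cylinder shift_space_in_alphabet [OF X] by blast
  moreover have "X \<subseteq> \<Union> (?C ` X)"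
    using shift_space_in_alphabet [OF X] by (auto simp: agree_def)
  ultimately obtain \<F> where \<F>: "finite \<F>" "\<F> \<subseteq> ?C ` X" "X \<subseteq> \<Union> \<F>"
    using compactinD by meson
  obtain D where "D \<subseteq> X" "finite D" "\<F> = ?C ` D"
    using finite_subset_image [OF \<F>(1,2)] by blast
  then have D: "D \<subseteq> X" "finite D" "X \<subseteq> \<Union> (?C ` D)" using \<F>(3) by auto
  have "UNIV = (\<Union>x\<in>D. {k. agree (- n x) (n x) (f k) x})"
    using D(3) f by fastforce
  moreover have "finite (\<Union>x\<in>D. {k. agree (- n x) (n x) (f k) x})"
    using D n by auto
  ultimately show False using infinite_UNIV_nat by metis
qed

lemma shift_space_closed:
  assumes "shift_space A X" "\<And>n. \<exists>p\<in>X. agree (- n) n p x"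
  shows "x \<in> X"
proof -
  have "\<forall>k::nat. \<exists>p. p \<in> X \<and> agree (- int k) (int k) p x" using assms(2) by blast
  then obtain f where f: "\<And>k::nat. f k \<in> X" "\<And>k. agree (- int k) (int k) (f k) x"
    by metis
  obtain z where z: "z \<in> X" "\<And>n. \<exists>\<^sub>\<infinity>k. agree (- n) n (f k) z"
    using shift_space_cluster [of A X f, OF assms(1) f(1)] by blast
  have "z = x"
  proof
    fix i
    obtain k where k: "k \<ge> nat \<bar>i\<bar>" "agree (- \<bar>i\<bar>) \<bar>i\<bar> (f k) z"
      using z(2) unfolding INFM_nat_le by blast
    show "z i = x i"
      using agreeD [OF k(2), of i] agreeD [OF f(2), of k i] k(1) by auto
  qed
  then show ?thesis using z(1) by simp
qed

text \<open>
  The Curtis--Hedlund--Lyndon theorem at position 0. Continuity of \<open>\<pi>\<close> at a cluster point of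
  pairs that agree on larger and larger windows excludes that their images differ at 0.
\<close>

lemma factor_code_local_at_0:
  assumes \<pi>: "factor_code A X B Y \<pi>"
  shows "\<exists>R\<ge>0. \<forall>x\<in>X. \<forall>z\<in>X. agree (- R) R x z \<longrightarrow> \<pi> x 0 = \<pi> z 0"
proof (rule ccontr)
  assume neg: "\<not> ?thesis"
  have X: "shift_space A X" using \<pi> by (simp add: factor_code_def)
  have "\<exists>x z. x \<in> X \<and> z \<in> X \<and> agree (- int k) (int k) x z \<and> \<pi> x 0 \<noteq> \<pi> z 0" for k
    using neg of_nat_0_le_iff by blast
  then obtain f g where fg: "\<And>k. f k \<in> X" "\<And>k. g k \<in> X" "\<And>k. agree (- int k) (int k) (f k) (g k)"
      "\<And>k. \<pi> (f k) 0 \<noteq> \<pi> (g k) 0"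
    by metis
  obtain x where x: "x \<in> X" "\<And>n. \<exists>\<^sub>\<infinity>k. agree (- n) n (f k) x"
    using shift_space_cluster [of A X f, OF X fg(1)] by blast
  have "continuous_map (subtopology (full_shift_topology A) X) (full_shift_topology B) \<pi>"
    using \<pi> unfolding factor_code_def by (simp add: continuous_map_in_subtopology)
  then have "continuous_map (subtopology (full_shift_topology A) X) (discrete_topology B) (\<lambda>x. \<pi> x 0)"
    unfolding full_shift_topology_def
    by (simp add: continuous_map_componentwise_UNIV)
  moreover have "\<pi> x \<in> Y" "shift_space B Y" using \<pi> x(1) by (auto simp: factor_code_def)
  then have "openin (discrete_topology B) {\<pi> x 0}"
    using shift_space_in_alphabet by auto
  ultimately have "openin (subtopology (full_shift_topology A) X)
      {z \<in> topspace (subtopology (full_shift_topology A) X). \<pi> z 0 \<in> {\<pi> x 0}}"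
    by (rule openin_continuous_map_preimage)
  then obtain T where T: "openin (full_shift_topology A) T"
      "{z \<in> topspace (subtopology (full_shift_topology A) X). \<pi> z 0 \<in> {\<pi> x 0}} = T \<inter> X"
    unfolding openin_subtopology by blast
  have sub: "X \<subseteq> topspace (full_shift_topology A)"
    using X by (simp add: shift_space_def closedin_subset)
  then have "x \<in> T" using T(2) x(1) by auto
  then obtain U where U: "finite {i. U i \<noteq> A}" "x \<in> PiE UNIV U" "PiE UNIV U \<subseteq> T"
    using T(1) unfolding full_shift_topology_def openin_product_topology_alt by auto
  define n where "n = Max (insert 0 (abs ` {i. U i \<noteq> A}))"
  have n: "\<bar>i\<bar> \<le> n" if "U i \<noteq> A" for i
    unfolding n_def using U(1) that by (intro Max_ge) auto
  \<comment> \<open>The radius \<open>n\<close> covers the finitely many coordinates that the basic open set \<open>U\<close> restricts.\<close>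
  have near: "\<pi> z 0 = \<pi> x 0" if z: "z \<in> X" "agree (- n) n z x" for z
  proof -
    have "z i \<in> U i" for i
    proof (cases "U i = A")
      case True then show ?thesis using shift_space_in_alphabet [OF X z(1)] by simp
    next
      case False
      then have "z i = x i" using n [of i] by (intro agreeD [OF z(2)]) auto
      then show ?thesis using U(2) by auto
    qed
    then have "z \<in> T \<inter> X" using U(3) z(1) by auto
    then show ?thesis using T(2) by blast
  qed
  obtain k where k: "k \<ge> nat n" "agree (- n) n (f k) x" using x(2) unfolding INFM_nat_le by blast
  have "agree (- n) n (g k) x"
    using k fg(3) [of k] by (auto simp: agree_def)
  then show False using near fg k(2) by metis
qed

lemma word_nth:
  assumes "ws = map p [i..j]" "q < length ws"
  shows "ws ! q = p (i + int q)"
  using assms by (simp add: nth_upto)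

lemma window_if_in_language:
  assumes "shift_map ` X = X" "map s [a..b] \<in> language X"
  shows "\<exists>p\<in>X. agree a b p s"
proof -
  obtain x i j where x: "x \<in> X" "map s [a..b] = map x [i..j]"
    using assms(2) unfolding language_def by blast
  have "agree a b (translate (i - a) x) s"
    unfolding agree_def
  proof (intro allI impI)
    fix t assume t: "a \<le> t" "t \<le> b"
    have len: "nat (t - a) < length (map s [a..b])" using t by simp
    show "translate (i - a) x t = s t"
      using word_nth [OF x(2) len] word_nth [OF HOL.refl len] t by (simp add: translate_def algebra_simps)
  qed
  then show ?thesis using translate_in_if_shift_invariant [OF assms(1) x(1)] by blast
qed

lemma upto_append: "a \<le> b + 1 \<Longrightarrow> b \<le> c \<Longrightarrow> [a..c] = [a..b] @ [b + 1..c]" for a b c :: int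
  by (cases "a = b + 1") (auto intro: upto_split2)

lemma language_window: "x \<in> X \<Longrightarrow> map x [a..b] \<in> language X"
  unfolding language_def by blast

text \<open>
  The finite type condition, applied to the common word of length \<open>k\<close>, puts every word of the
  splice into the language, and a shift space contains each point all of whose words are in
  its language.
\<close>

lemma finite_type_splice:
  assumes X: "shift_space A X"
    and k: "\<And>u w v. w \<in> language X \<Longrightarrow> length w = k \<Longrightarrow> u @ w \<in> language X \<Longrightarrow>
       w @ v \<in> language X \<Longrightarrow> u @ w @ v \<in> language X"
    and xz: "x \<in> X" "z \<in> X" "agree (i + 1) (i + int k) x z"
  shows "splice_at i x z \<in> X"
proof (rule shift_space_closed [OF X])
  fix n
  let ?s = "splice_at i x z"
  \<comment> \<open>The window is enlarged so that it contains the common word and meets both parts.\<close>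
  define a b where "a = min (- n) i" and "b = max n (i + int k)"
  define u w v where "u = map x [a..i]" and "w = map x [i + 1..i + int k]"
    and "v = map z [i + int k + 1..b]"
  have w: "w = map z [i + 1..i + int k]"
    using xz(3) by (auto simp: w_def agree_def)
  have "u @ w = map x [a..i + int k]"
    using upto_append [of a i "i + int k"] by (simp add: u_def w_def a_def)
  moreover have "w @ v = map z [i + 1..b]"
    using upto_append [of "i + 1" "i + int k" b] by (simp add: v_def w b_def)
  moreover have "length w = k" by (simp add: w_def)
  moreover have "w \<in> language X" by (simp add: w_def language_window xz)
  ultimately have "u @ w @ v \<in> language X"
    using k [of w u v] language_window xz(1,2) by metis
  moreover have "map ?s [a..b] = u @ w @ v"
    using upto_append [of a i b] upto_append [of "i + 1" "i + int k" b]
    by (simp add: u_def w v_def a_def b_def splice_at_def)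
  ultimately obtain p where "p \<in> X" "agree a b p ?s"
    using window_if_in_language X unfolding shift_space_def by metis
  then show "\<exists>p\<in>X. agree (- n) n p ?s"
    using agree_mono [of a b p ?s "- n" n] by (auto simp: a_def b_def)
qed

text \<open>
  If \<open>u w v\<close> occurs in a point of \<open>X\<close>, where \<open>u\<close> and \<open>v\<close> have length \<open>2 * n + 1\<close>, then the centre of
  \<open>v\<close> lies \<open>2 * n + 1 + length w\<close> to the right of the centre of \<open>u\<close>.
\<close>

lemma irreducible_connect:
  assumes X: "shift_map ` X = X" "irreducible_shift X" and xz: "x \<in> X" "z \<in> X" "0 \<le> n"
  shows "\<exists>t>n. \<exists>s\<in>X. agree (- n) n s x \<and> agree (- n) n (translate t s) z"
proof -
  define u v where "u = map x [- n..n]" and "v = map z [- n..n]"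
  have "u \<in> language X" "v \<in> language X" by (auto simp: u_def v_def language_window xz)
  then obtain w where "u @ w @ v \<in> language X" using X(2) unfolding irreducible_shift_def by blast
  then obtain p i j where p: "p \<in> X" "u @ w @ v = map p [i..j]"
    unfolding language_def by blast
  have len: "length u = nat (2 * n + 1)" "length v = nat (2 * n + 1)" by (auto simp: u_def v_def)
  have word: "(u @ w @ v) ! q = p (i + int q)" if "q < length (u @ w @ v)" for q
    using word_nth [OF p(2) that] .
  let ?s = "translate (i + n) p" and ?t = "2 * n + 1 + int (length w)"
  have "agree (- n) n ?s x"
    unfolding agree_def
  proof (intro allI impI)
    fix l assume l: "- n \<le> l" "l \<le> n"
    have "(u @ w @ v) ! nat (l + n) = x l"
      using l len by (simp add: nth_append) (simp add: u_def nth_upto)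
    then show "?s l = x l"
      using word [of "nat (l + n)"] l len by (simp add: translate_def algebra_simps)
  qed
  moreover have "agree (- n) n (translate ?t ?s) z"
    unfolding agree_def
  proof (intro allI impI)
    fix l assume l: "- n \<le> l" "l \<le> n"
    define q where "q = length u + (length w + nat (l + n))"
    have q: "q < length (u @ w @ v)" "int q = ?t + l + n" using l len xz(3) by (auto simp: q_def)
    have "(u @ w @ v) ! q = v ! nat (l + n)" by (simp add: q_def nth_append)
    also have "\<dots> = z l" using l by (simp add: v_def nth_upto)
    finally show "translate ?t ?s l = z l"
      using word [OF q(1)] by (simp add: translate_def q(2) algebra_simps)
  qed
  ultimately show ?thesis
    using translate_in_if_shift_invariant [OF X(1) p(1)] xz(3)
    by (intro exI [of _ ?t] conjI bexI [of _ ?s]) auto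
qed

lemma fibre_system_if_factor_code:
  assumes sft: "shift_of_finite_type A X" and irr: "irreducible_shift X"
    and \<pi>: "factor_code A X B Y \<pi>"
  shows "\<exists>L. fibre_system A X \<pi> L"
proof -
  obtain k where X: "shift_space A X"
    and k: "\<And>u w v. w \<in> language X \<Longrightarrow> length w = k \<Longrightarrow> u @ w \<in> language X \<Longrightarrow>
       w @ v \<in> language X \<Longrightarrow> u @ w @ v \<in> language X"
    using sft unfolding shift_of_finite_type_def by blast
  have inv: "shift_map ` X = X" using X by (simp add: shift_space_def)
  obtain R where R: "R \<ge> 0" "\<And>x z. x \<in> X \<Longrightarrow> z \<in> X \<Longrightarrow> agree (- R) R x z \<Longrightarrow> \<pi> x 0 = \<pi> z 0"
    using factor_code_local_at_0 [OF \<pi>] by blast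
  define L where "L = max (int k) R"
  note tr = translate_in_if_shift_invariant [OF inv]
  have comm: "\<pi> (translate t x) = translate t (\<pi> x)" if "x \<in> X" for t x
    using commutes_with_translate [OF inv _ that] \<pi> unfolding factor_code_def by blast
  have "fibre_system A X \<pi> L"
  proof
    show "finite A" using X by (simp add: shift_space_def)
    show "0 \<le> L" using R by (simp add: L_def)
    show "\<pi> x i = \<pi> z i" if xz: "x \<in> X" "z \<in> X" "agree (i - L) (i + L) x z" for x z i
    proof -
      have "agree (- R) R (translate i x) (translate i z)"
        unfolding agree_translate by (rule agree_mono [OF xz(3)]) (auto simp: L_def)
      then have "\<pi> (translate i x) 0 = \<pi> (translate i z) 0" using R tr xz by blast
      then show ?thesis using comm xz by (simp add: translate_def)
    qed
    show "splice_at i x z \<in> X" if xz: "x \<in> X" "z \<in> X" "agree (i - L) (i + L) x z" for x z i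
      by (rule finite_type_splice [OF X k xz(1,2)])
        (auto intro!: agree_mono [OF xz(3)] simp: L_def)
  qed (use shift_space_in_alphabet [OF X] shift_space_cluster [OF X] tr comm
      irreducible_connect [OF inv irr] in blast)+
  then show ?thesis ..
qed

section \<open>Constancy of the class numbers\<close>

theorem corollary5p4:
  fixes A :: "'a set" and X :: "(int \<Rightarrow> 'a) set"
    and B :: "'b set" and Y :: "(int \<Rightarrow> 'b) set"
    and \<pi> :: "(int \<Rightarrow> 'a) \<Rightarrow> (int \<Rightarrow> 'b)"
  assumes "shift_of_finite_type A X"
    and "irreducible_shift X"
    and "sofic_shift B Y"
    and "factor_code A X B Y \<pi>"
  shows "constant_class_to_one X Y \<pi> \<longleftrightarrow> constant_left_class_to_one X Y \<pi>"
proof -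
  obtain L where "fibre_system A X \<pi> L" using fibre_system_if_factor_code assms by blast
  then interpret fwd: fibre_system A X \<pi> L .
  interpret rev: fibre_system A "reflect ` X" "reflect \<circ> \<pi> \<circ> reflect" L
    by (rule fwd.fibre_system_reflect)
  have Y: "Y = \<pi> ` X" using assms(4) by (simp add: factor_code_def)
  let ?r = "right_class_number X \<pi>" and ?l = "left_class_number X \<pi>"
  have right_to_left: "\<forall>y\<in>Y. ?l y \<le> d" if "\<forall>y\<in>Y. ?r y \<le> d" for d
    using fwd.left_class_number_le_if_right that unfolding Y by blast
  have left_to_right: "\<forall>y\<in>Y. ?r y \<le> d" if "\<forall>y\<in>Y. ?l y \<le> d" for d
  proof -
    have "?r (\<pi> x) \<le> d" if "x \<in> X" for x
    proof -
      have "left_class_number (reflect ` X) (reflect \<circ> \<pi> \<circ> reflect)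
          ((reflect \<circ> \<pi> \<circ> reflect) (reflect x)) \<le> d"
      proof (rule rev.left_class_number_le_if_right)
        fix x' assume "x' \<in> reflect ` X"
        then show "right_class_number (reflect ` X) (reflect \<circ> \<pi> \<circ> reflect)
            ((reflect \<circ> \<pi> \<circ> reflect) x') \<le> d"
          using \<open>\<forall>y\<in>Y. ?l y \<le> d\<close> unfolding Y by (auto simp: right_class_number_reflect)
      qed (use that in blast)
      then show ?thesis by (simp add: left_class_number_reflect)
    qed
    then show ?thesis unfolding Y by blast
  qed
  have attained: "\<exists>y'\<in>Y. ?r y' \<le> ?l y" if "y \<in> Y" for y
  proof -
    obtain x where x: "x \<in> X" "y = \<pi> x" using \<open>y \<in> Y\<close> Y by blast
    obtain x' where "x' \<in> reflect ` X" "left_class_number (reflect ` X) (reflect \<circ> \<pi> \<circ> reflect)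
          ((reflect \<circ> \<pi> \<circ> reflect) x') \<le> right_class_number (reflect ` X) (reflect \<circ> \<pi> \<circ> reflect)
          ((reflect \<circ> \<pi> \<circ> reflect) (reflect x))"
      using rev.left_class_number_le_right x(1) by blast
    then show ?thesis
      unfolding Y x(2) by (auto simp: left_class_number_reflect right_class_number_reflect)
  qed
  \<comment> \<open>The class degree is defined by right class numbers, but bounds the left ones as well.\<close>
  have min_right: "class_degree X Y \<pi> \<le> ?r y" if "y \<in> Y" for y
    unfolding class_degree_def by (rule cINF_lower [OF _ that]) simp
  then have min_left: "class_degree X Y \<pi> \<le> ?l y" if "y \<in> Y" for y
    using attained [OF that] order_trans by blast
  show ?thesis
    unfolding constant_class_to_one_def constant_left_class_to_one_def
  proof
    assume "\<forall>y\<in>Y. ?r y = class_degree X Y \<pi>"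
    then have "\<forall>y\<in>Y. ?l y \<le> class_degree X Y \<pi>" by (intro right_to_left) simp
    then show "\<forall>y\<in>Y. ?l y = class_degree X Y \<pi>" using min_left order_antisym by blast
  next
    assume "\<forall>y\<in>Y. ?l y = class_degree X Y \<pi>"
    then have "\<forall>y\<in>Y. ?r y \<le> class_degree X Y \<pi>" by (intro left_to_right) simp
    then show "\<forall>y\<in>Y. ?r y = class_degree X Y \<pi>" using min_right order_antisym by blast
  qed
qed

end
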